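(* Let $(a,b)\in\Omega$ be an irrational point (i.e. $b/a\notin\mathbb{Q}$), and for $n\ge 1$ let $f_{-n}=\sum_{i=0}^n\left(k_{-i}(a,b)-3\right)$. Let $e^+=e^+(b/a)$ and $e^-=e^-(b/a)$ be the even and odd Diophantine exponents of $b/a$, respectively. Then $$\limsup_{n\rightarrow+\infty}\frac{\log|f_{-n}|}{\log n}=\max\left\{\frac{e^+-1}{e^+},\frac{e^--2}{e^-}\right\}.$$
   Context: The BCZ triangle (Farey triangle) is $\Omega=\{(a,b)\in\mathbb{R}^2 : a,b\in(0,1],\ a+b>1\}$. With $[x]$ denoting the integer part (floor) of $x$, the itinerary function is $k(a,b)=\left[\frac{1+a}{b}\right]$ and the BCZ map $T:\Omega\to\Omega$ is the bijection $T(a,b)=\left(b,-a+\left[\frac{1+a}{b}\right]b\right)$. For $n\in\mathbb{Z}$, $k_n(a,b):=k(T^{n-1}(a,b))$. A point $(a,b)\in\Omega$ is called irrational if $b/a$ is irrational. For an irrational number $s$, the even Diophantine exponent $e^+(s)$ is the supremum of all $v\in\mathbb{R}$ such that $0<\frac pq-s<\frac1{q^v}$ has infinitely many solutions $\frac pq\in\mathbb{Q}$, and the odd Diophantine exponent $e^-(s)$ is the supremum of all $v\in\mathbb{R}$ such that $0<s-\frac pq<\frac1{q^v}$ has infinitely many solutions $\frac pq\in\mathbb{Q}$ (here $p/q$ is in lowest terms with $q\ge1$). These are elements of $[2,+\infty]$; if an exponent $e^{\pm}$ is $+\infty$, the fractions $\frac{e^\pm-1}{e^\pm}$ and $\frac{e^\pm-2}{e^\pm}$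 are read as $1$. Also $\log 0=-\infty$. *)

theory Defs
  imports "HOL-Library.Extended_Real"
begin

definition BCZ_triangle :: "(real \<times> real) set" where
  "BCZ_triangle = {(a, b). 0 < a \<and> a \<le> 1 \<and> 0 < b \<and> b \<le> 1 \<and> a + b > 1}"

definition itinerary :: "real \<times> real \<Rightarrow> int" where
  "itinerary = (\<lambda>(a, b). \<lfloor>(1 + a) / b\<rfloor>)"

text \<open>The map is written as a total function on the plane; only its restriction to
  \<^const>\<open>BCZ_triangle\<close>, which is a bijection of the triangle (lemma \<open>bij_betw_BCZ\<close> below),
  is meaningful.\<close>

definition BCZ :: "real \<times> real \<Rightarrow> real \<times> real" where
  "BCZ = (\<lambda>(a, b). (b, - a + of_int \<lfloor>(1 + a) / b\<rfloor> * b))"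

definition BCZ_iter :: "int \<Rightarrow> real \<times> real \<Rightarrow> real \<times> real" where
  "BCZ_iter n = (if n \<ge> 0 then BCZ ^^ nat n else inv_into BCZ_triangle BCZ ^^ nat (- n))"

definition itinerary_at :: "int \<Rightarrow> real \<times> real \<Rightarrow> int" where
  "itinerary_at n x = itinerary (BCZ_iter (n - 1) x)"

text \<open>\<open>f_neg x n\<close> is the sum usually written with the negative index \<open>-n\<close>.\<close>

definition f_neg :: "real \<times> real \<Rightarrow> nat \<Rightarrow> int" where
  "f_neg x n = (\<Sum>i = 0..n. (itinerary_at (- int i) x - 3))"

text \<open>Solutions of the Diophantine inequalities are counted as rational numbers;
  \<^const>\<open>quotient_of\<close> gives the fraction in lowest terms with positive denominator.\<close>

definition rat_denom :: "rat \<Rightarrow> int" where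
  "rat_denom r = snd (quotient_of r)"

definition even_exponent :: "real \<Rightarrow> ereal" where
  "even_exponent s = Sup {ereal v | v.
     infinite {r :: rat. 0 < of_rat r - s \<and> of_rat r - s < 1 / of_int (rat_denom r) powr v}}"

definition odd_exponent :: "real \<Rightarrow> ereal" where
  "odd_exponent s = Sup {ereal v | v.
     infinite {r :: rat. 0 < s - of_rat r \<and> s - of_rat r < 1 / of_int (rat_denom r) powr v}}"

text \<open>The quotient \<open>(e - c) / e\<close>, read as \<open>1\<close> for \<open>e = \<infinity>\<close>
  (where \<^typ>\<open>ereal\<close> division would give \<open>0\<close>).\<close>

definition exponent_ratio :: "real \<Rightarrow> ereal \<Rightarrow> ereal" where
  "exponent_ratio c e = (if e = \<infinity> then 1 else (e - ereal c) / e)"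

text \<open>Logarithm with \<open>log 0 = -\<infinity>\<close>, whereas \<^const>\<open>ln\<close> on the reals has \<open>ln 0 = 0\<close>.\<close>

definition elog :: "real \<Rightarrow> ereal" where
  "elog x = (if x = 0 then -\<infinity> else ereal (ln x))"

lemma BCZ_in_triangle:
  assumes "x \<in> BCZ_triangle"
  shows "BCZ x \<in> BCZ_triangle"
proof -
  obtain a b where x: "x = (a, b)" by (cases x)
  have ab: "0 < a" "a \<le> 1" "0 < b" "b \<le> 1" "a + b > 1"
    using assms by (auto simp: x BCZ_triangle_def)
  define k where "k = real_of_int \<lfloor>(1 + a) / b\<rfloor>"
  have "k \<le> (1 + a) / b" "(1 + a) / b < k + 1"
    unfolding k_def by linarith+
  hence "k * b \<le> 1 + a" "1 + a < (k + 1) * b"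
    using ab by (simp_all add: field_simps)
  thus ?thesis
    using ab by (simp add: x BCZ_def BCZ_triangle_def k_def[symmetric] algebra_simps)
qed

text \<open>The inverse map is conjugate to the map itself by the reflection of the triangle.\<close>

lemma BCZ_swap_BCZ:
  assumes "x \<in> BCZ_triangle"
  shows "prod.swap (BCZ (prod.swap (BCZ x))) = x"
proof -
  obtain a b where x: "x = (a, b)" by (cases x)
  have ab: "0 < a" "a \<le> 1" "0 < b" "b \<le> 1" "a + b > 1"
    using assms by (auto simp: x BCZ_triangle_def)
  define k where "k = \<lfloor>(1 + a) / b\<rfloor>"
  have "\<lfloor>(1 + (- a + of_int k * b)) / b\<rfloor> = k"
    using ab by (intro floor_unique) (auto simp: field_simps)
  thus ?thesis
    by (simp add: x BCZ_def k_def[symmetric])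
qed

lemma swap_in_triangle: "prod.swap x \<in> BCZ_triangle \<longleftrightarrow> x \<in> BCZ_triangle"
  by (cases x) (auto simp: BCZ_triangle_def)

lemma bij_betw_BCZ: "bij_betw BCZ BCZ_triangle BCZ_triangle"
proof (rule bij_betw_byWitness[where f' = "\<lambda>x. prod.swap (BCZ (prod.swap x))"])
  show "\<forall>x\<in>BCZ_triangle. BCZ (prod.swap (BCZ (prod.swap x))) = x"
    by (metis BCZ_swap_BCZ swap_in_triangle swap_swap)
  show "BCZ ` BCZ_triangle \<subseteq> BCZ_triangle"
    by (auto intro: BCZ_in_triangle)
  show "(\<lambda>x. prod.swap (BCZ (prod.swap x))) ` BCZ_triangle \<subseteq> BCZ_triangle"
    by (intro image_subsetI) (simp only: swap_in_triangle BCZ_in_triangle)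
qed (use BCZ_swap_BCZ in blast)

end

(* By the reflection symmetry of the triangle, the backward orbit of (a, b) is the forward orbit
   of (b, a), whose coordinates c_0 = b, c_1 = a, c_2, ... satisfy
   c_(j+2) = k_j c_(j+1) - c_j, where k_j = k(T^j(b, a)).  They are the values
   c_j = L(v_j) of the linear form L(x, h) = x b + h a at the primitive integer vectors v_j with
   0 < L <= 1 and h >= 0, listed by increasing slope sigma_j = h(v_j) / c_j; consecutive ones have
   determinant 1.  Up to boundary terms, the sum of k_j - 3 is the sum of
   c_j / c_(j+1) + c_(j+1) / c_j - 3 over consecutive pairs, and this total does not change when a
   vector that is the sum of its two neighbours is removed.  So one may pass to a chain in which
   all coefficients are at least 2.  There the heights h double at each coefficient >= 3, whence
   there are only O(log sigma_n) such coefficients and O(log sigma_n) runs of coefficients 2.  A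
   large coefficient, or a run with direction u, L(u) > 0, yields a good approximation of b/a from
   above; a long run with L(u) < 0 yields one from below.  Together with
   sigma_n = n^(1+o(1)) this bounds the sum by the Diophantine exponents; conversely
   a good approximation from above is some v_j with k_(j-1) about 2 / c_j, and a good approximation
   from below produces a long run of coefficients 2. *)

theory Submission
  imports Defs
begin

section \<open>Chains of unimodular vectors\<close>

text \<open>The obstacle is cancellation: coefficients 1 and 2 offset the large ones, so estimating
  \<open>k_j - 3\<close> term by term is hopeless. Dropping sums of neighbours performs the
  cancellation exactly. The two ratios come from comparing sizes with slopes. Let a direction have
  height h and approximation exponent e. From above, L is about h^(1-e), so the coefficient is about
  h^(e-1), and it is met at slope h / L, about h^e. From below, a run starts at a value about 1 / h
  and loses about h^(1-e) per step; it has about h^(e-2) steps and ends at slope about h^e again.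
  Turning slopes into indices threatens to be circular, because \<sigma>_n is a sum of terms b /
  (c_j c_(j+1)) that are controlled by the very weights to be estimated. The circle is broken by an
  a priori bound: c_j is at least a constant over j + 1. With the logarithmic counts this already
  gives a weight sum of order n log \<sigma>_n, and hence the growth of \<sigma>_n.\<close>

definition det2 :: "int \<times> int \<Rightarrow> int \<times> int \<Rightarrow> int" where
  "det2 p q = fst p * snd q - snd p * fst q"

definition edge_weight :: "real \<Rightarrow> real \<Rightarrow> real" where
  "edge_weight x y = x / y + y / x - 3"

lemma det2_self [simp]: "det2 p p = 0"
  by (simp add: det2_def)

text \<open>The Pluecker relation of four plane vectors; with unit determinants it becomes the
  recurrence with coefficient \<open>det2 p r\<close>, valid for every functional
  \<open>det2 z\<close>.\<close>

lemma det2_three_term: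
  assumes "det2 p q = 1" "det2 q r = 1"
  shows "det2 z p + det2 z r = det2 p r * det2 z q"
proof -
  have "det2 z p * det2 q r + det2 z r * det2 p q = det2 p r * det2 z q"
    unfolding det2_def by algebra
  thus ?thesis using assms by simp
qed

text \<open>The fractions over \<open>x + y\<close> add up to 1 and the inverted ones exceed
  \<open>x / y + y / x\<close> by 2, so inserting a sum of neighbours costs exactly 3. No other
  constant makes the weight invariant.\<close>

lemma edge_weight_mediant:
  assumes "x > 0" "y > 0"
  shows "edge_weight x (x + y) + edge_weight (x + y) y = edge_weight x y"
proof -
  have "x + y \<noteq> 0" using assms by simp
  have "x / (x + y) + y / (x + y) = 1"
    using \<open>x + y \<noteq> 0\<close> by (simp add: add_divide_distrib[symmetric])
  moreover have "(x + y) / x = 1 + y / x" "(x + y) / y = 1 + x / y"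
    using assms by (simp_all add: add_divide_distrib)
  ultimately show ?thesis by (simp add: edge_weight_def)
qed

text \<open>In this form a weight is seen to be at least -1, and close to -1 for nearly equal
  values: a slow arithmetic progression weighs about -1 per edge.\<close>

lemma edge_weight_alt:
  assumes "x > 0" "y > 0"
  shows "edge_weight x y = (x - y)\<^sup>2 / (x * y) - 1"
  using assms by (simp add: edge_weight_def field_simps power2_eq_square)

lemma edge_weight_le:
  assumes "x \<ge> t" "y \<ge> t" "t > 0" "\<bar>x - y\<bar> \<le> \<epsilon>"
  shows "edge_weight x y \<le> (\<epsilon> / t)\<^sup>2 - 1"
proof -
  have "(x - y)\<^sup>2 / (x * y) \<le> \<epsilon>\<^sup>2 / (t * t)"
    using assms abs_le_square_iff[of "x - y" \<epsilon>] by (intro frac_le mult_mono) auto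
  thus ?thesis using assms edge_weight_alt[of x y] by (simp add: power_divide power2_eq_square)
qed

text \<open>Divide \<open>1 <= (x + y)^2 <= 2 (x^2 + y^2)\<close> by \<open>x y\<close>.\<close>

lemma inverse_prod_le_edge_weight:
  assumes "x > 0" "y > 0" "x + y \<ge> 1"
  shows "1 / (x * y) \<le> 2 * edge_weight x y + 6"
proof -
  have "1 \<le> (x + y)\<^sup>2"
    using assms(3)
      by (simp add: power2_eq_square) (metis mult_mono mult_1 assms(3) le_numeral_extra(1) order_trans zero_le_one)
  also have "\<dots> \<le> 2 * (x\<^sup>2 + y\<^sup>2)"
    using zero_le_power2[of "x - y"] by (simp add: power2_eq_square algebra_simps)
  finally show ?thesis
    using assms by (simp add: edge_weight_def field_simps power2_eq_square)
qed

definition linear_form :: "real \<Rightarrow> real \<Rightarrow> int \<times> int \<Rightarrow> real" where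
  "linear_form \<alpha> \<beta> p = of_int (fst p) * \<alpha> + of_int (snd p) * \<beta>"

lemma linear_form_three_term:
  assumes "det2 p q = 1" "det2 q r = 1"
  shows "linear_form \<alpha> \<beta> p + linear_form \<alpha> \<beta> r = of_int (det2 p r) * linear_form \<alpha> \<beta> q"
proof -
  have "of_int (det2 q r) * linear_form \<alpha> \<beta> p + of_int (det2 p q) * linear_form \<alpha> \<beta> r
      = of_int (det2 p r) * linear_form \<alpha> \<beta> q"
    unfolding det2_def linear_form_def by (simp add: algebra_simps)
  thus ?thesis using assms by simp
qed

lemma linear_form_basis:
  assumes "det2 w u = 1"
  shows "linear_form \<alpha> \<beta> z = of_int (det2 z u) * linear_form \<alpha> \<beta> w + of_int (det2 w z) * linear_form \<alpha> \<beta> u"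
proof -
  have "of_int (det2 w u) * linear_form \<alpha> \<beta> z = of_int (det2 z u) * linear_form \<alpha> \<beta> w + of_int (det2 w z) * linear_form \<alpha> \<beta> u"
    unfolding det2_def linear_form_def by (simp add: algebra_simps)
  thus ?thesis using assms by simp
qed

text \<open>Since \<open>snd\<close> is a linear form too, this compares slopes: for \<alpha> > 0
  and positive values of the form, the sign of \<open>det2 p q\<close> tells which of
  \<open>p\<close>, \<open>q\<close> has the larger slope.\<close>

lemma det2_linear_form:
  "linear_form \<alpha> \<beta> p * of_int (snd q) - of_int (snd p) * linear_form \<alpha> \<beta> q = \<alpha> * of_int (det2 p q)"
  unfolding det2_def linear_form_def by (simp add: algebra_simps)

section \<open>Chains and their reduction\<close>

definition chain :: "(nat \<Rightarrow> int \<times> int) \<Rightarrow> nat \<Rightarrow> bool" where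
  "chain w r \<longleftrightarrow> (\<forall>i<r. det2 (w i) (w (Suc i)) = 1)"

text \<open>The determinant of two vertices at distance 2 is the coefficient k in
  \<open>w i + w (Suc (Suc i)) = k w (Suc i)\<close>. Note that \<open>r\<close> counts
  edges.\<close>

definition reduced :: "(nat \<Rightarrow> int \<times> int) \<Rightarrow> nat \<Rightarrow> bool" where
  "reduced w r \<longleftrightarrow> chain w r \<and> (\<forall>i. Suc i < r \<longrightarrow> det2 (w i) (w (Suc (Suc i))) \<ge> 2)"

definition chain_weight :: "(int \<times> int \<Rightarrow> real) \<Rightarrow> (nat \<Rightarrow> int \<times> int) \<Rightarrow> nat \<Rightarrow> real" where
  "chain_weight l w r = (\<Sum>i<r. edge_weight (l (w i)) (l (w (Suc i))))"

text \<open>If the new vector makes the last coefficient equal to 1, the last vertex is the sum of its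
  neighbours and is dropped; this is repeated down the stack.\<close>

lemma reduced_push:
  fixes \<alpha> \<beta> :: real
  defines "l \<equiv> linear_form \<alpha> \<beta>"
  assumes "reduced w r" "det2 (w r) z = 1" "\<And>i. i \<le> r \<Longrightarrow> l (w i) > 0"
    "l z > 0"
  shows "\<exists>w' r'. reduced w' r' \<and> r' \<ge> 1 \<and> w' 0 = w 0 \<and> w' r' = z \<and>
    w' ` {..r'} \<subseteq> insert z (w ` {..r}) \<and>
    chain_weight l w' r' = chain_weight l w r + edge_weight (l (w r)) (l z)"
  using assms(2-4)
proof (induction r)
  case 0
  thus ?case
    by (intro exI[of _ "w(1 := z)"] exI[of _ 1])
       (auto simp: reduced_def chain_def chain_weight_def le_Suc_eq)
next
  case (Suc m)
  define k where "k = det2 (w m) z"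
  have d1: "det2 (w m) (w (Suc m)) = 1"
    using Suc.prems(1) by (auto simp: reduced_def chain_def)
  have sum: "l (w m) + l z = of_int k * l (w (Suc m))"
    unfolding l_def k_def using linear_form_three_term[OF d1 Suc.prems(2)] .
  have pos: "l (w m) > 0" "l (w (Suc m)) > 0" using Suc.prems(3) by auto
  \<comment> \<open>Positivity of \<open>l\<close> excludes coefficients below 1; what remains is 1
    (drop the vertex) or at least 2 (keep it).\<close>
  have "of_int k * l (w (Suc m)) > 0" using sum pos assms(5) by linarith
  hence "k \<ge> 1" using pos by (simp add: zero_less_mult_iff)
  then consider "k = 1" | "k \<ge> 2" by linarith
  thus ?case
  proof cases
    case 1
    have red: "reduced w m" using Suc.prems(1) by (auto simp: reduced_def chain_def)
    obtain w' r' where *: "reduced w' r'" "r' \<ge> 1" "w' 0 = w 0" "w' r' = z"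
      "w' ` {..r'} \<subseteq> insert z (w ` {..m})"
      "chain_weight l w' r' = chain_weight l w m + edge_weight (l (w m)) (l z)"
      using Suc.IH[OF red] Suc.prems(3) 1 k_def by auto
    have "edge_weight (l (w m)) (l z) = edge_weight (l (w m)) (l (w (Suc m))) + edge_weight (l (w (Suc m))) (l z)"
      using edge_weight_mediant[of "l (w m)" "l z"] pos assms(5) sum 1 by simp
    hence "chain_weight l w' r' = chain_weight l w (Suc m) + edge_weight (l (w (Suc m))) (l z)"
      using *(6) by (simp add: chain_weight_def)
    moreover have "w' ` {..r'} \<subseteq> insert z (w ` {..Suc m})"
      using *(5) by (auto simp: atMost_Suc)
    ultimately show ?thesis using * by blast
  next
    case 2
    define w' where "w' = w(Suc (Suc m) := z)"
    have "reduced w' (Suc (Suc m))"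
      using Suc.prems 2 unfolding reduced_def chain_def k_def w'_def
      by (auto simp: less_Suc_eq)
    moreover have
      "chain_weight l w' (Suc (Suc m)) = chain_weight l w (Suc m) + edge_weight (l (w (Suc m))) (l z)"
      by (simp add: chain_weight_def w'_def)
    moreover have "w' 0 = w 0" "w' (Suc (Suc m)) = z"
      "w' ` {..Suc (Suc m)} \<subseteq> insert z (w ` {..Suc m})"
      by (auto simp: w'_def le_Suc_eq)
    ultimately show ?thesis
      by (intro exI[of _ w'] exI[of _ "Suc (Suc m)"]) simp
  qed
qed

text \<open>Only vertices of the given chain survive, so every bound known along it is inherited by
  the reduced chain.\<close>

lemma reduced_subchain:
  fixes \<alpha> \<beta> :: real
  defines "l \<equiv> linear_form \<alpha> \<beta>"
  assumes "chain v n" "n \<ge> 1" "\<And>i. i \<le> n \<Longrightarrow> l (v i) > 0"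
  obtains w r where "reduced w r" "r \<ge> 1" "w 0 = v 0" "w r = v n"
    "w ` {..r} \<subseteq> v ` {..n}"
    "chain_weight l w r = chain_weight l v n"
proof -
  have "\<exists>w r. reduced w r \<and> r \<ge> 1 \<and> w 0 = v 0 \<and> w r = v n \<and> w ` {..r} \<subseteq> v ` {..n} \<and>
    chain_weight l w r = chain_weight l v n"
    using assms(3,2,4)
  proof (induction n rule: dec_induct)
    case base
    thus ?case by (intro exI[of _ v] exI[of _ 1]) (auto simp: reduced_def)
  next
    case (step n)
    have "chain v n" using step.prems(1) by (auto simp: chain_def)
    then obtain w r where *: "reduced w r" "r \<ge> 1" "w 0 = v 0" "w r = v n"
      "w ` {..r} \<subseteq> v ` {..n}"
      "chain_weight l w r = chain_weight l v n" using step by auto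
    have 1: "det2 (w r) (v (Suc n)) = 1" using step.prems(1) *(4) by (auto simp: chain_def)
    have 2: "l (w i) > 0" if "i \<le> r" for i
    proof -
      have "w i \<in> v ` {..n}" using *(5) that by auto
      thus ?thesis using step.prems(2) by auto
    qed
    obtain w' r' where **: "reduced w' r'" "r' \<ge> 1" "w' 0 = w 0" "w' r' = v (Suc n)"
      "w' ` {..r'} \<subseteq> insert (v (Suc n)) (w ` {..r})"
      "chain_weight l w' r' = chain_weight l w r + edge_weight (l (w r)) (l (v (Suc n)))"
      using reduced_push[OF *(1) 1 2[unfolded l_def] step.prems(2)[unfolded l_def]] unfolding l_def
        by auto
    have "w' ` {..r'} \<subseteq> v ` {..Suc n}" using **(5) *(5) by (auto simp: atMost_Suc)
    moreover have "chain_weight l w' r' = chain_weight l v (Suc n)"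
      using **(6) *(4,6) by (simp add: chain_weight_def)
    ultimately show ?case using * ** by auto
  qed
  thus thesis using that by blast
qed

section \<open>Heights and coefficient counts in a reduced chain\<close>

context
  fixes w :: "nat \<Rightarrow> int \<times> int" and r :: nat
  assumes red: "reduced w r"
begin

lemma reduced_three_term:
  assumes "Suc i < r"
  shows "det2 z (w i) + det2 z (w (Suc (Suc i))) = det2 (w i) (w (Suc (Suc i))) * det2 z (w (Suc i))"
  using red assms by (intro det2_three_term) (auto simp: reduced_def chain_def)

lemma reduced_linear_form:
  assumes "Suc i < r"
  shows "linear_form \<alpha> \<beta> (w i) + linear_form \<alpha> \<beta> (w (Suc (Suc i))) =
    of_int (det2 (w i) (w (Suc (Suc i)))) * linear_form \<alpha> \<beta> (w (Suc i))"
  using red assms by (intro linear_form_three_term) (auto simp: reduced_def chain_def)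

text \<open>Coefficients of at least 2 make the heights convex in the index, and they start with 0
  and 1.\<close>

lemma reduced_height_Suc:
  "i < r \<Longrightarrow> 0 \<le> det2 (w 0) (w i) \<and> det2 (w 0) (w i) < det2 (w 0) (w (Suc i))"
proof (induction i)
  case 0
  thus ?case using red by (auto simp: reduced_def chain_def)
next
  case (Suc i)
  let ?k = "det2 (w i) (w (Suc (Suc i)))"
  have "?k \<ge> 2" using red Suc.prems by (auto simp: reduced_def)
  hence "?k * det2 (w 0) (w (Suc i)) \<ge> 2 * det2 (w 0) (w (Suc i))"
    using Suc by (intro mult_right_mono) auto
  moreover have "0 \<le> det2 (w 0) (w i)" "det2 (w 0) (w i) < det2 (w 0) (w (Suc i))"
    using Suc by auto
  ultimately show ?case using reduced_three_term[of i "w 0"] Suc.prems by linarith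
qed

lemma reduced_height_mono:
  assumes "i \<le> j" "j \<le> r"
  shows "det2 (w 0) (w i) \<le> det2 (w 0) (w j)"
  using assms
proof (induction j rule: dec_induct)
  case (step n)
  thus ?case using reduced_height_Suc[of n] by auto
qed auto

lemma reduced_height_pos:
  assumes "1 \<le> i" "i \<le> r"
  shows "det2 (w 0) (w i) \<ge> 1"
  using reduced_height_Suc[of "i - 1"] assms by (cases i) auto

lemma reduced_height_doubles:
  assumes "Suc i < r" "det2 (w i) (w (Suc (Suc i))) \<ge> 3"
  shows "2 * det2 (w 0) (w (Suc i)) \<le> det2 (w 0) (w (Suc (Suc i)))"
proof -
  have "3 * det2 (w 0) (w (Suc i)) \<le> det2 (w i) (w (Suc (Suc i))) * det2 (w 0) (w (Suc i))"
    using assms reduced_height_pos[of "Suc i"] by (intro mult_right_mono) auto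
  moreover have "det2 (w 0) (w i) < det2 (w 0) (w (Suc i))"
    using reduced_height_Suc[of i] assms by auto
  ultimately show ?thesis using reduced_three_term[OF assms(1), of "w 0"] by linarith
qed

text \<open>Each coefficient is the sum of the two fractions whose denominator is the value at its
  vertex. Unpaired are the two fractions over the end values, and there is one more edge than there
  are coefficients, hence the last 3.\<close>

lemma chain_weight_eq_sum:
  fixes \<alpha> \<beta> :: real
  defines "l \<equiv> linear_form \<alpha> \<beta>"
  assumes pos: "\<And>i. i \<le> r \<Longrightarrow> l (w i) > 0" and "Suc n \<le> r"
  shows "chain_weight l w (Suc n) = (\<Sum>i<n. real_of_int (det2 (w i) (w (Suc (Suc i)))) - 3)
    + l (w 1) / l (w 0) + l (w n) / l (w (Suc n)) - 3"
  using assms(3)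
proof (induction n)
  case 0
  thus ?case by (simp add: chain_weight_def edge_weight_def)
next
  case (Suc n)
  have "l (w n) + l (w (Suc (Suc n))) = of_int (det2 (w n) (w (Suc (Suc n)))) * l (w (Suc n))"
    using reduced_linear_form[of n \<alpha> \<beta>] Suc.prems by (simp add: l_def)
  hence "real_of_int (det2 (w n) (w (Suc (Suc n)))) = l (w n) / l (w (Suc n)) + l (w (Suc (Suc n))) / l (w (Suc n))"
    using pos[of "Suc n"] Suc.prems by (simp add: field_simps)
  moreover have
    "chain_weight l w (Suc (Suc n)) = chain_weight l w (Suc n) + edge_weight (l (w (Suc n))) (l (w (Suc (Suc n))))"
    by (simp add: chain_weight_def)
  ultimately show ?case using Suc by (simp add: edge_weight_def)
qed

lemma reduced_ge_2:
  assumes "Suc i < r"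
  shows "det2 (w i) (w (Suc (Suc i))) \<ge> 2"
  using red assms by (auto simp: reduced_def)

text \<open>\<open>P * log 2\<close> of the height is a potential: a coefficient of at least 3
  contributes less than \<open>P\<close> and raises the potential by at least \<open>P\<close>,
  while a coefficient 2 contributes -1.\<close>

lemma reduced_sum_upper:
  fixes P :: real
  assumes P: "\<And>i. Suc i < r \<Longrightarrow> real_of_int (det2 (w i) (w (Suc (Suc i)))) \<le> P" "P \<ge> 0"
    and "Suc n \<le> r"
  shows "(\<Sum>i<n. real_of_int (det2 (w i) (w (Suc (Suc i)))) - 3) \<le> P * log 2 (det2 (w 0) (w (Suc n)))"
  using assms(3)
proof (induction n)
  case 0
  thus ?case using red by (simp add: reduced_def chain_def)
next
  case (Suc n)
  define d where "d = (\<lambda>i. real_of_int (det2 (w 0) (w i)))"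
  have d1: "d (Suc n) \<ge> 1" using reduced_height_pos[of "Suc n"] Suc.prems by (simp add: d_def)
  have dm: "d (Suc n) \<le> d (Suc (Suc n))"
    using reduced_height_mono[of "Suc n" "Suc (Suc n)"] Suc.prems by (simp add: d_def)
  have IH: "(\<Sum>i<n. real_of_int (det2 (w i) (w (Suc (Suc i)))) - 3) \<le> P * log 2 (d (Suc n))"
    using Suc by (simp add: d_def)
  show ?case
  proof (cases "det2 (w n) (w (Suc (Suc n))) \<ge> 3")
    case True
    have "2 * d (Suc n) \<le> d (Suc (Suc n))"
      using reduced_height_doubles[of n] True Suc.prems by (simp add: d_def)
    hence "log 2 (2 * d (Suc n)) \<le> log 2 (d (Suc (Suc n)))" using d1 by simp
    hence "1 + log 2 (d (Suc n)) \<le> log 2 (d (Suc (Suc n)))" using d1 by (simp add: log_mult)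
    hence "P * (1 + log 2 (d (Suc n))) \<le> P * log 2 (d (Suc (Suc n)))"
      using P(2) by (rule mult_left_mono)
    thus ?thesis using IH P(1)[of n] Suc.prems by (simp add: algebra_simps d_def)
  next
    case False
    have "P * log 2 (d (Suc n)) \<le> P * log 2 (d (Suc (Suc n)))"
      using P(2) d1 dm by (intro mult_left_mono) auto
    thus ?thesis using IH False by (simp add: d_def)
  qed
qed

text \<open>Induction over the last coefficient other than 2: the run behind it costs at most
  \<open>Q\<close>, and the coefficient itself, being at least 3, doubles the height and so pays for
  \<open>Q\<close> in the logarithmic term. In the hypothesis \<open>m\<close> counts edges, so the
  run has \<open>m - 1\<close> coefficients.\<close>

lemma reduced_count_twos:
  fixes Q :: real
  assumes Q: "\<And>i m. m \<ge> 1 \<Longrightarrow> i + m \<le> r \<Longrightarrow>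
      (\<And>t. Suc t < m \<Longrightarrow> det2 (w (i + t)) (w (i + Suc (Suc t))) = 2) \<Longrightarrow> real m \<le> Q"
    and "Suc n \<le> r"
  shows "real (card {i. i < n \<and> det2 (w i) (w (Suc (Suc i))) = 2}) \<le> Q + Q * log 2 (det2 (w 0) (w (Suc n)))"
  using assms(2)
proof (induction n rule: less_induct)
  case (less n)
  define d where "d = (\<lambda>i. real_of_int (det2 (w 0) (w i)))"
  define T where "T = (\<lambda>n. {i. i < n \<and> det2 (w i) (w (Suc (Suc i))) = 2})"
  have d1: "d i \<ge> 1" if "1 \<le> i" "i \<le> r" for i
    using reduced_height_pos[OF that] by (simp add: d_def)
  \<comment> \<open>A single edge has no inner vertex, so for \<open>m = 1\<close> the condition on
    the coefficients is vacuous.\<close>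
  have Q1: "Q \<ge> 1" using Q[of 1 0] less.prems by simp
  show ?case
  proof (cases "\<exists>i<n. det2 (w i) (w (Suc (Suc i))) \<noteq> 2")
    case False
    have "card (T n) \<le> n" using card_mono[of "{..<n}" "T n"] by (auto simp: T_def)
    moreover have "real (Suc n) \<le> Q" using False less.prems by (intro Q[of "Suc n" 0]) auto
    moreover have "0 \<le> Q * log 2 (d (Suc n))"
      using Q1 d1[of "Suc n"] less.prems by (intro mult_nonneg_nonneg) auto
    ultimately show ?thesis by (simp add: T_def d_def)
  next
    case True
    define S where "S = {i. i < n \<and> det2 (w i) (w (Suc (Suc i))) \<noteq> 2}"
    have S: "finite S" "S \<noteq> {}" using True by (auto simp: S_def)
    define j where "j = Max S"
    have j: "j < n" "det2 (w j) (w (Suc (Suc j))) \<noteq> 2"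
      using Max_in[OF S] by (auto simp: j_def S_def)
    have two: "det2 (w i) (w (Suc (Suc i))) = 2" if "j < i" "i < n" for i
    proof (rule ccontr)
      assume "det2 (w i) (w (Suc (Suc i))) \<noteq> 2"
      hence "i \<in> S" using that by (simp add: S_def)
      hence "i \<le> j" using S(1) by (simp add: j_def)
      thus False using that by simp
    qed
    have "T n \<subseteq> T j \<union> {Suc j..<n}"
    proof
      fix x assume "x \<in> T n"
      moreover have "x \<noteq> j" using \<open>x \<in> T n\<close> j by (auto simp: T_def)
      ultimately show "x \<in> T j \<union> {Suc j..<n}" by (auto simp: T_def)
    qed
    hence "card (T n) \<le> card (T j \<union> {Suc j..<n})" by (intro card_mono) (auto simp: T_def)
    also have "\<dots> \<le> card (T j) + (n - Suc j)"
      using card_Un_le[of "T j" "{Suc j..<n}"] by simp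
    finally have c: "card (T n) \<le> card (T j) + (n - Suc j)" .
    have "real (n - j) \<le> Q"
    proof (rule Q[of _ "Suc j"])
      show "det2 (w (Suc j + t)) (w (Suc j + Suc (Suc t))) = 2" if "Suc t < n - j" for t
        using two[of "Suc j + t"] that by simp
    qed (use j less.prems in auto)
    moreover have "real (card (T j)) \<le> Q + Q * log 2 (d (Suc j))"
      using less.IH[of j] j less.prems by (simp add: T_def d_def)
    moreover have "Q * log 2 (d (Suc j)) + Q \<le> Q * log 2 (d (Suc n))"
    proof -
      have "det2 (w j) (w (Suc (Suc j))) \<ge> 3" using j reduced_ge_2[of j] less.prems by simp
      hence "2 * d (Suc j) \<le> d (Suc (Suc j))"
        using reduced_height_doubles[of j] j less.prems by (simp add: d_def)
      also have "\<dots> \<le> d (Suc n)"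
        using reduced_height_mono[of "Suc (Suc j)" "Suc n"] j less.prems by (simp add: d_def)
      finally have "log 2 (2 * d (Suc j)) \<le> log 2 (d (Suc n))"
        using d1[of "Suc j"] j less.prems by simp
      hence "1 + log 2 (d (Suc j)) \<le> log 2 (d (Suc n))"
        using d1[of "Suc j"] j less.prems by (simp add: log_mult)
      hence "Q * (1 + log 2 (d (Suc j))) \<le> Q * log 2 (d (Suc n))"
        using Q1 by (intro mult_left_mono) auto
      thus ?thesis by (simp add: algebra_simps)
    qed
    moreover have "real (card (T n)) \<le> real (card (T j)) + real (n - j)" using c by linarith
    ultimately have "real (card (T n)) \<le> Q + Q * log 2 (d (Suc n))" by linarith
    thus ?thesis by (simp add: T_def d_def)
  qed
qed

lemma reduced_sum_lower:
  assumes "Suc n \<le> r"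
  shows "- real (card {i. i < n \<and> det2 (w i) (w (Suc (Suc i))) = 2}) \<le>
    (\<Sum>i<n. real_of_int (det2 (w i) (w (Suc (Suc i)))) - 3)"
proof -
  have "- real (card {i. i < n \<and> det2 (w i) (w (Suc (Suc i))) = 2}) =
      (\<Sum>i<n. if det2 (w i) (w (Suc (Suc i))) = 2 then - 1 else 0)"
    by (subst sum.inter_filter[symmetric]) (auto intro!: arg_cong[where f = card])
  also have "\<dots> \<le> (\<Sum>i<n. real_of_int (det2 (w i) (w (Suc (Suc i)))) - 3)"
  proof (rule sum_mono)
    fix i assume "i \<in> {..<n}"
    hence "det2 (w i) (w (Suc (Suc i))) \<ge> 2" using reduced_ge_2[of i] assms by auto
    thus "(if det2 (w i) (w (Suc (Suc i))) = 2 then - 1 else 0) \<le> real_of_int (det2 (w i) (w (Suc (Suc i)))) - 3"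
      by auto
  qed
  finally show ?thesis .
qed

end

text \<open>A coefficient 2 means a vanishing second difference.\<close>

lemma reduced_run:
  assumes w: "reduced w r" and "i + m \<le> r"
    and two: "\<And>t. Suc t < m \<Longrightarrow> det2 (w (i + t)) (w (i + Suc (Suc t))) = 2"
  shows "t \<le> m \<Longrightarrow> linear_form \<alpha> \<beta> (w (i + t)) =
    linear_form \<alpha> \<beta> (w i) + real t * (linear_form \<alpha> \<beta> (w (Suc i)) - linear_form \<alpha> \<beta> (w i))"
proof (induction t rule: less_induct)
  case (less t)
  consider "t = 0" | "t = 1" | t' where "t = Suc (Suc t')"
  proof (cases t)
    case (Suc s)
    thus ?thesis using that by (cases s) auto
  qed (use that in auto)
  thus ?case
  proof cases
    case 3
    have "linear_form \<alpha> \<beta> (w (i + t')) + linear_form \<alpha> \<beta> (w (i + t)) = 2 * linear_form \<alpha> \<beta> (w (i + Suc t'))"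
      using reduced_linear_form[OF w, of "i + t'" \<alpha> \<beta>] two[of t'] 3 less.prems assms(2)
        by simp
    thus ?thesis using less.IH[of t'] less.IH[of "Suc t'"] 3 less.prems by (simp add: algebra_simps)
  qed simp_all
qed

text \<open>A reduced chain from \<open>w 0\<close> to \<open>w 0 + m u\<close> must be the
  arithmetic progression with step \<open>u\<close>. In the induction step the last but one vertex
  is pinned down by integrality: \<open>e (m + 1) = d + 1\<close> with \<open>0 <= d < m + 1\<close>
  leaves only \<open>e = 1\<close>.\<close>

lemma reduced_segment_weight:
  fixes \<alpha> \<beta> :: real
  defines "l \<equiv> linear_form \<alpha> \<beta>"
  assumes "reduced w r" "m \<ge> 1" "r \<ge> 1" "det2 (w 0) u = 1" "det2 (w 0) (w r) = int m"
    "det2 (w r) u = 1"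
  shows "chain_weight l w r =
    (\<Sum>k<m. edge_weight (l (w 0) + real k * l u) (l (w 0) + real (Suc k) * l u))"
  using assms(3,2,4-)
proof (induction m arbitrary: r rule: dec_induct)
  case base
  then obtain q where q: "r = Suc q" by (cases r) auto
  have "q = 0"
  proof (rule ccontr)
    assume "q \<noteq> 0"
    hence "det2 (w 0) (w q) \<ge> 1" using reduced_height_pos[OF base(1), of q] q by simp
    moreover have "det2 (w 0) (w q) < 1" using reduced_height_Suc[OF base(1), of q] base q by simp
    ultimately show False by simp
  qed
  moreover have "l (w r) = l (w 0) + l u"
    using linear_form_basis[OF base(3), of \<alpha> \<beta> "w r"] base by (simp add: l_def)
  ultimately show ?case by (simp add: q chain_weight_def)
next
  case (step m)
  then obtain q where q: "r = Suc q" by (cases r) auto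
  define d e where "d = det2 (w 0) (w q)" and "e = det2 (w q) u"
  have d: "0 \<le> d" "d < 1 + int m"
    using reduced_height_Suc[OF step.prems(1), of q] step.prems q by (auto simp: d_def)
  have "det2 (w q) (w r) = 1" using step.prems(1) q by (auto simp: reduced_def chain_def)
  moreover have "det2 (w 0) u * det2 (w q) (w r) = e * det2 (w 0) (w r) - d * det2 (w r) u"
    unfolding det2_def d_def e_def by algebra
  ultimately have eq: "e * (1 + int m) = 1 + d" using step.prems by simp
  hence "e * (1 + int m) > 0" using d by simp
  hence "e \<ge> 1" by (simp add: zero_less_mult_iff)
  have "e < 2"
  proof (rule ccontr)
    assume "\<not> e < 2"
    hence "2 * (1 + int m) \<le> e * (1 + int m)" by (intro mult_right_mono) auto
    thus False using eq d by simp
  qed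
  hence e: "e = 1" using \<open>e \<ge> 1\<close> by simp
  hence "d = int m" using eq by simp
  note e = e this
  have "q \<ge> 1" using e step.hyps by (cases q) (auto simp: d_def)
  have "reduced w q" using step.prems(1) q by (auto simp: reduced_def chain_def)
  hence "chain_weight l w q = (\<Sum>k<m. edge_weight (l (w 0) + real k * l u) (l (w 0) + real (Suc k) * l u))"
    using step.IH[of q] \<open>q \<ge> 1\<close> e step.prems by (simp add: d_def e_def)
  moreover have "l (w r) = l (w 0) + real (Suc m) * l u" "l (w q) = l (w 0) + real m * l u"
    using linear_form_basis[OF step.prems(3), of \<alpha> \<beta> "w r"] linear_form_basis[OF step.prems(3), of \<alpha> \<beta> "w q"]
      step.prems e by (simp_all add: l_def d_def e_def)
  ultimately show ?case by (simp add: chain_weight_def q)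
qed

section \<open>One-sided rational approximation\<close>

lemma rat_denom_pos: "rat_denom r > 0"
  by (cases "quotient_of r") (auto simp: rat_denom_def dest: quotient_of_denom_pos)

lemma rat_denom_le:
  assumes "of_rat r = of_int q / (of_int p :: real)" "p \<ge> 1"
  shows "rat_denom r \<le> p"
proof -
  obtain n d where nd: "quotient_of r = (n, d)" by (cases "quotient_of r")
  have d: "d > 0" "coprime n d" using nd quotient_of_denom_pos quotient_of_coprime by auto
  have "of_rat r = of_int n / (of_int d :: real)"
    using quotient_of_div[OF nd] by (simp add: of_rat_divide)
  hence "of_int (n * p) = (of_int (q * d) :: real)"
    using assms d by (simp add: field_simps)
  hence "n * p = q * d" by (simp only: of_int_eq_iff)
  hence "d dvd n * p" by simp
  hence "d dvd p" using d(2) by (simp add: coprime_dvd_mult_right_iff coprime_commute)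
  thus ?thesis using nd assms(2) by (simp add: rat_denom_def zdvd_imp_le)
qed

text \<open>The sign \<open>sg\<close> is \<open>1\<close> for the even and \<open>- 1\<close> for the odd exponent.\<close>

definition approximants :: "int \<Rightarrow> real \<Rightarrow> real \<Rightarrow> rat set" where
  "approximants sg s v = {r. 0 < of_int sg * (of_rat r - s) \<and>
     of_int sg * (of_rat r - s) < 1 / of_int (rat_denom r) powr v}"

definition side_exponent :: "int \<Rightarrow> real \<Rightarrow> ereal" where
  "side_exponent sg s = Sup {ereal v | v. infinite (approximants sg s v)}"

lemma even_exponent_eq: "even_exponent s = side_exponent 1 s"
  by (simp add: even_exponent_def side_exponent_def approximants_def)

lemma odd_exponent_eq: "odd_exponent s = side_exponent (- 1) s"
  by (simp add: odd_exponent_def side_exponent_def approximants_def)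

lemma approximants_antimono:
  assumes "v \<le> v'"
  shows "approximants sg s v' \<subseteq> approximants sg s v"
proof
  fix r assume "r \<in> approximants sg s v'"
  moreover have "real_of_int (rat_denom r) powr v \<le> of_int (rat_denom r) powr v'"
    using assms rat_denom_pos[of r] by (intro powr_mono) auto
  hence "1 / real_of_int (rat_denom r) powr v' \<le> 1 / of_int (rat_denom r) powr v"
    using rat_denom_pos[of r] by (intro divide_left_mono) auto
  ultimately show "r \<in> approximants sg s v" by (auto simp: approximants_def)
qed

lemma finite_approximants:
  assumes "side_exponent sg s < ereal v"
  shows "finite (approximants sg s v)"
proof (rule ccontr)
  assume "infinite (approximants sg s v)"
  hence "ereal v \<le> side_exponent sg s"
    unfolding side_exponent_def by (intro Sup_upper) auto
  thus False using assms by simp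
qed

lemma infinite_approximants:
  assumes "ereal v < side_exponent sg s"
  shows "infinite (approximants sg s v)"
proof -
  obtain v' where "infinite (approximants sg s v')" "v < v'"
    using assms unfolding side_exponent_def less_Sup_iff by auto
  thus ?thesis using approximants_antimono[of v v' sg s] finite_subset by fastforce
qed

text \<open>Fractions outside the finite set violate its inequality, and the exceptions have a
  positive least distance. Unreduced fractions are covered because cancelling only lowers the
  denominator.\<close>

lemma approximants_gap:
  assumes fin: "finite (approximants sg s v)" and "v \<ge> 0"
  obtains \<delta> where "\<delta> > 0"
    "\<And>p q. \<lbrakk>p \<ge> 1; 0 < of_int sg * (of_int q / of_int p - s)\<rbrakk> \<Longrightarrow>
    \<delta> * of_int p powr (- v) \<le> of_int sg * (of_int q / of_int p - s)"
proof
  \<comment> \<open>The entry 1 keeps the set nonempty and gives \<open>\<delta> <= 1\<close> for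
    the fractions that are no exceptions.\<close>
  define A where "A = insert 1 ((\<lambda>r. of_int sg * (of_rat r - s)) ` approximants sg s v)"
  define \<delta> where "\<delta> = Min A"
  have A: "finite A" "A \<noteq> {}" using fin by (auto simp: A_def)
  show "\<delta> > 0" unfolding \<delta>_def
    using A by (subst Min_gr_iff) (auto simp: A_def approximants_def)
  have "\<delta> \<le> 1" unfolding \<delta>_def using A by (intro Min_le) (auto simp: A_def)
  fix p q :: int
  assume p: "p \<ge> 1" and pos: "0 < of_int sg * (of_int q / of_int p - s)"
  define r where "r = of_int q / (of_int p :: rat)"
  have r: "of_rat r = of_int q / (of_int p :: real)" by (simp add: r_def of_rat_divide)
  have d: "1 \<le> rat_denom r" "rat_denom r \<le> p"
    using rat_denom_pos[of r] rat_denom_le[OF r p] by auto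
  have le1: "of_int p powr (- v) \<le> 1"
    using p assms(2) by (simp add: powr_minus ge_one_powr_ge_zero field_simps)
  show "\<delta> * of_int p powr (- v) \<le> of_int sg * (of_int q / of_int p - s)"
  proof (cases "r \<in> approximants sg s v")
    case True
    have "\<delta> * of_int p powr (- v) \<le> \<delta> * 1"
      using le1 \<open>\<delta> > 0\<close> by (intro mult_left_mono) auto
    also have "\<delta> \<le> of_int sg * (of_rat r - s)"
      unfolding \<delta>_def using A True by (intro Min_le) (auto simp: A_def)
    finally show ?thesis by (simp add: r)
  next
    case False
    have "\<delta> * of_int p powr (- v) \<le> 1 * of_int p powr (- v)"
      using \<open>\<delta> \<le> 1\<close> by (intro mult_right_mono) auto
    also have "\<dots> \<le> of_int (rat_denom r) powr (- v)"
      using d assms(2) by (simp add: powr_mono2')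
    also have "\<dots> \<le> of_int sg * (of_rat r - s)"
      using False pos r by (simp add: approximants_def powr_minus_divide)
    finally show ?thesis by (simp add: r)
  qed
qed

text \<open>Rounding to the chosen side gives an error below \<open>1 / q\<close> for every
  \<open>q\<close>, nonzero by irrationality; arbitrarily small errors need infinitely many
  fractions. The bound makes the divisions in \<open>exponent_ratio\<close> harmless.\<close>

lemma side_exponent_ge_1:
  assumes "s \<notin> \<rat>" "sg = 1 \<or> sg = - 1"
  shows "side_exponent sg s \<ge> 1"
proof -
  define f where "f = (\<lambda>r. of_int sg * (of_rat r - s))"
  have ex: "\<exists>r\<in>approximants sg s 1. f r < 1 / real q" if q: "q \<ge> 1" for q :: nat
  proof -
    \<comment> \<open>With the sign inside and outside, the ceiling rounds up for
      \<open>sg = 1\<close> and down for \<open>sg = - 1\<close>.\<close>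
    define n where "n = sg * \<lceil>of_int sg * s * real q\<rceil>"
    define r where "r = of_int n / (of_int (int q) :: rat)"
    have r: "of_rat r = of_int n / (of_int (int q) :: real)" by (simp add: r_def of_rat_divide)
    have sg: "real_of_int sg * of_int sg = 1" using assms(2) by auto
    have eq:
      "f r = (of_int \<lceil>of_int sg * s * real q\<rceil> - of_int sg * s * real q) / real q"
      using q sg by (simp add: f_def r n_def field_simps)
    have "of_int sg * s * real q \<noteq> of_int k" for k
    proof
      assume *: "of_int sg * s * real q = of_int k"
      have "s = of_int sg * of_int k / real q"
        unfolding *[symmetric] using sg q by (simp add: field_simps)
      thus False using assms(1) by simp
    qed
    hence "of_int \<lceil>of_int sg * s * real q\<rceil> > of_int sg * s * real q"
      by (metis le_of_int_ceiling order_le_less)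
    moreover have "of_int \<lceil>of_int sg * s * real q\<rceil> - of_int sg * s * real q < 1"
      by linarith
    ultimately have f: "0 < f r" "f r < 1 / real q"
      using q by (simp_all add: eq divide_strict_right_mono)
    have "rat_denom r \<le> int q" using r q by (intro rat_denom_le) auto
    hence "1 / real q \<le> 1 / of_int (rat_denom r)"
      using rat_denom_pos[of r] by (intro divide_left_mono) auto
    hence "f r < 1 / of_int (rat_denom r) powr 1" using f rat_denom_pos[of r] by simp
    thus ?thesis using f by (auto simp: approximants_def f_def)
  qed
  have "infinite (approximants sg s 1)"
  proof
    assume fin: "finite (approximants sg s 1)"
    define \<delta> where "\<delta> = Min (f ` approximants sg s 1)"
    have ne: "approximants sg s 1 \<noteq> {}" using ex[of 1] by auto
    have "\<delta> > 0" unfolding \<delta>_def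
      using fin ne by (subst Min_gr_iff) (auto simp: approximants_def f_def)
    then obtain q where q: "inverse (real (Suc q)) < \<delta>" using reals_Archimedean by blast
    obtain r where "r \<in> approximants sg s 1" "f r < 1 / real (Suc q)"
      using ex[of "Suc q"] by auto
    moreover have "\<delta> \<le> f r" unfolding \<delta>_def
      using fin calculation(1) by (intro Min_le) auto
    ultimately show False using q by (simp add: inverse_eq_divide)
  qed
  hence "ereal 1 \<le> side_exponent sg s" unfolding side_exponent_def by (intro Sup_upper) blast
  thus ?thesis by (simp add: one_ereal_def)
qed

text \<open>Bounded denominators together with distances below 1 would leave only finitely many
  numerators.\<close>

lemma approximants_large_denom:
  assumes inf: "infinite (approximants sg s v)" and "sg = 1 \<or> sg = - 1" "v \<ge> 0"
  obtains r where "r \<in> approximants sg s v" "real_of_int (rat_denom r) > M"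
proof -
  have "\<exists>r\<in>approximants sg s v. real_of_int (rat_denom r) > M"
  proof (rule ccontr)
    assume "\<not> ?thesis"
    hence M: "real_of_int (rat_denom r) \<le> M" if "r \<in> approximants sg s v" for r
      using that by force
    define B where "B = \<lceil>(\<bar>s\<bar> + 1) * M\<rceil>"
    have "quotient_of ` approximants sg s v \<subseteq> {- B..B} \<times> {1..\<lfloor>M\<rfloor>}"
    proof
      fix x assume "x \<in> quotient_of ` approximants sg s v"
      then obtain r where r: "r \<in> approximants sg s v" "x = quotient_of r" by auto
      obtain n d where nd: "quotient_of r = (n, d)" by (cases "quotient_of r")
      have dd: "rat_denom r = d" by (simp add: rat_denom_def nd)
      have d: "d \<ge> 1" "of_int d \<le> M"
        using rat_denom_pos[of r] M[OF r(1)] by (simp_all add: dd)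
      have eq: "of_rat r = of_int n / (of_int d :: real)"
        using quotient_of_div[OF nd] by (simp add: of_rat_divide)
      have "1 / of_int d powr v \<le> (1 :: real)"
        using d assms(3) ge_one_powr_ge_zero[of "of_int d" v] by simp
      hence "\<bar>of_rat r - s\<bar> < 1" using r(1) assms(2) by (auto simp: approximants_def dd)
      hence "\<bar>of_rat r\<bar> \<le> \<bar>s\<bar> + 1" by linarith
      hence "\<bar>of_rat r\<bar> * of_int d \<le> (\<bar>s\<bar> + 1) * M"
        using d by (intro mult_mono) auto
      hence "\<bar>real_of_int n\<bar> \<le> (\<bar>s\<bar> + 1) * M"
        using d by (simp add: eq abs_divide)
      hence "\<bar>n\<bar> \<le> B" unfolding B_def by linarith
      thus "x \<in> {- B..B} \<times> {1..\<lfloor>M\<rfloor>}"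
        using d by (auto simp: r(2) nd le_floor_iff)
    qed
    hence "finite (quotient_of ` approximants sg s v)" by (rule finite_subset) auto
    moreover have "inj_on quotient_of (approximants sg s v)"
      by (intro inj_onI) (simp add: quotient_of_inject)
    ultimately show False using inf finite_imageD by blast
  qed
  thus thesis using that by blast
qed

lemma one_plus_log2_le_powr:
  fixes x \<eta> :: real
  assumes "x \<ge> 1" "\<eta> > 0"
  shows "1 + log 2 x \<le> (1 + 1 / (\<eta> * ln 2)) * x powr \<eta>"
proof -
  have "ln x \<le> x powr \<eta> / \<eta>" using assms by (intro ln_powr_bound) auto
  hence "log 2 x \<le> (1 / (\<eta> * ln 2)) * x powr \<eta>"
    using assms by (simp add: log_def field_simps)
  moreover have "1 \<le> x powr \<eta>" using assms by (simp add: ge_one_powr_ge_zero)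
  ultimately show ?thesis by (simp add: algebra_simps)
qed

text \<open>Reduce \<open>y\<close> modulo \<open>q\<close>. The pair completes
  \<open>(- p, q)\<close> to a lattice basis by a vector of smaller height.\<close>

lemma bezout_reduced:
  fixes p q :: int
  assumes "coprime p q" "q \<ge> 1"
  obtains x y where "x * q + y * p = 1" "0 \<le> y" "y < q"
proof -
  obtain x0 y0 where "x0 * q + y0 * p = 1"
    using bezout_int[of q p] assms(1) by (auto simp: coprime_iff_gcd_eq_1 gcd.commute)
  hence "(x0 + (y0 div q) * p) * q + (y0 mod q) * p = 1"
    by (simp add: algebra_simps) (metis add.assoc add.commute distrib_left div_mult_mod_eq mult.commute mult.left_commute)
  thus thesis using that[of "x0 + (y0 div q) * p" "y0 mod q"] assms by simp
qed

text \<open>For \<open>x = 0\<close> the quotient is -\<infinity> and both sides are true;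
  \<open>n >= 2\<close> makes the denominator positive.\<close>

lemma elog_ratio_less_iff:
  assumes "x \<ge> 0" "n \<ge> 2"
  shows "elog x / ereal (ln (real n)) < ereal y \<longleftrightarrow> x < real n powr y"
proof (cases "x = 0")
  case False
  hence x: "x > 0" using assms by simp
  have "ln x / ln (real n) < y \<longleftrightarrow> ln x < ln (real n powr y)"
    using assms by (simp add: field_simps ln_powr)
  also have "\<dots> \<longleftrightarrow> x < real n powr y"
    using x assms by (intro ln_less_cancel_iff) auto
  finally show ?thesis using False assms by (simp add: elog_def)
qed (use assms in \<open>simp add: elog_def ereal_divide_eq\<close>)

lemma less_elog_ratio_iff:
  assumes "x \<ge> 0" "n \<ge> 2"
  shows "ereal y < elog x / ereal (ln (real n)) \<longleftrightarrow> real n powr y < x"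
proof (cases "x = 0")
  case False
  hence x: "x > 0" using assms by simp
  have "y < ln x / ln (real n) \<longleftrightarrow> ln (real n powr y) < ln x"
    using assms by (simp add: field_simps ln_powr)
  also have "\<dots> \<longleftrightarrow> real n powr y < x"
    using x assms by (intro ln_less_cancel_iff) auto
  finally show ?thesis using False assms by (simp add: elog_def)
qed (use assms in \<open>simp add: elog_def\<close>)

section \<open>The reversed orbit as a chain of lattice vectors\<close>

locale bcz_orbit =
  fixes a b :: real
  assumes in_triangle: "(a, b) \<in> BCZ_triangle"
    and irrational: "b / a \<notin> \<rat>"
begin

lemma ab: "0 < a" "a \<le> 1" "0 < b" "b \<le> 1" "a + b > 1"
  using in_triangle by (auto simp: BCZ_triangle_def)

definition c :: "nat \<Rightarrow> real" where
  "c n = fst ((BCZ ^^ n) (b, a))"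

definition \<kappa> :: "nat \<Rightarrow> int" where
  "\<kappa> n = itinerary ((BCZ ^^ n) (b, a))"

lemma orbit_eq: "(BCZ ^^ n) (b, a) = (c n, c (Suc n))"
  by (cases "(BCZ ^^ n) (b, a)") (simp add: c_def BCZ_def)

lemma orbit_in_triangle: "(c n, c (Suc n)) \<in> BCZ_triangle"
proof (induction n)
  case 0
  thus ?case using ab by (simp add: c_def BCZ_triangle_def BCZ_def)
next
  case (Suc n)
  thus ?case using BCZ_in_triangle[OF Suc.IH] orbit_eq[of "Suc n"] orbit_eq[of n] by simp
qed

lemma c_0: "c 0 = b" and c_1: "c (Suc 0) = a"
  by (simp_all add: c_def BCZ_def)

lemma \<kappa>_eq: "\<kappa> n = \<lfloor>(1 + c n) / c (Suc n)\<rfloor>"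
  by (simp add: \<kappa>_def orbit_eq itinerary_def)

lemma c_pos: "0 < c n" and c_le_1: "c n \<le> 1" and c_sum: "c n + c (Suc n) > 1"
  using orbit_in_triangle[of n] by (auto simp: BCZ_triangle_def)

lemma c_rec: "c (Suc (Suc n)) = of_int (\<kappa> n) * c (Suc n) - c n"
proof -
  have "(BCZ ^^ Suc n) (b, a) = BCZ ((BCZ ^^ n) (b, a))" by simp
  also have "\<dots> = (c (Suc n), of_int (\<kappa> n) * c (Suc n) - c n)"
    unfolding orbit_eq by (simp add: BCZ_def \<kappa>_eq)
  finally have "(BCZ ^^ Suc n) (b, a) = (c (Suc n), of_int (\<kappa> n) * c (Suc n) - c n)" .
  thus ?thesis using orbit_eq[of "Suc n"] by simp
qed

lemma inverse_orbit:
  "(inv_into BCZ_triangle BCZ ^^ n) (a, b) = (c (Suc n), c n)"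
proof (induction n)
  case 0
  show ?case by (simp add: c_0 c_1)
next
  case (Suc n)
  let ?y = "(c (Suc (Suc n)), c (Suc n))"
  have y: "?y \<in> BCZ_triangle"
    using orbit_in_triangle[of "Suc n"] swap_in_triangle[of ?y] by simp
  have "prod.swap (BCZ (prod.swap (BCZ (c n, c (Suc n))))) = (c n, c (Suc n))"
    by (intro BCZ_swap_BCZ orbit_in_triangle)
  moreover have "BCZ (c n, c (Suc n)) = (c (Suc n), c (Suc (Suc n)))"
    using orbit_eq[of n] orbit_eq[of "Suc n"] by simp
  ultimately have "BCZ ?y = (c (Suc n), c n)"
    by (metis prod.swap_def fst_conv snd_conv swap_swap)
  hence "inv_into BCZ_triangle BCZ (c (Suc n), c n) = ?y"
    using inv_into_f_f[OF bij_betw_imp_inj_on[OF bij_betw_BCZ] y] by simp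
  thus ?case using Suc by simp
qed

text \<open>By the recurrence, \<open>(1 + c (i + 2)) / c (i + 1)\<close> equals
  \<open>\<kappa> i + (1 - c i) / c (i + 1)\<close>, and the last fraction lies in [0, 1) because
  \<open>c i <= 1 < c i + c (i + 1)\<close>.\<close>

lemma itinerary_at_neg: "itinerary_at (- int i) (a, b) = \<kappa> i"
proof -
  have "- int i - 1 = - int (Suc i)" "(0 \<le> - int (Suc i)) = False" by simp_all
  hence "BCZ_iter (- int i - 1) (a, b) = (c (Suc (Suc i)), c (Suc i))"
    by (simp only: BCZ_iter_def if_False inverse_orbit minus_minus nat_int)
  hence "itinerary_at (- int i) (a, b) = \<lfloor>(1 + c (Suc (Suc i))) / c (Suc i)\<rfloor>"
    by (simp add: itinerary_at_def itinerary_def)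
  also have "\<dots> = \<kappa> i"
  proof (rule floor_unique)
    have pos: "c (Suc i) > 0" by (rule c_pos)
    show "of_int (\<kappa> i) \<le> (1 + c (Suc (Suc i))) / c (Suc i)"
      using c_rec[of i] c_le_1[of i] pos by (simp add: field_simps)
    show "(1 + c (Suc (Suc i))) / c (Suc i) < of_int (\<kappa> i) + 1"
      using c_rec[of i] c_sum[of i] pos by (simp add: field_simps)
  qed
  finally show ?thesis .
qed

definition S :: "nat \<Rightarrow> int" where
  "S n = (\<Sum>j<n. \<kappa> j - 3)"

lemma f_neg_eq: "f_neg (a, b) n = S (Suc n)"
  by (simp add: f_neg_def S_def itinerary_at_neg atLeast0AtMost lessThan_Suc_atMost)

lemma \<kappa>_pos: "\<kappa> n \<ge> 1"
proof -
  have "of_int (\<kappa> n) * c (Suc n) > 0"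
    using c_rec[of n] c_pos[of n] c_pos[of "Suc (Suc n)"] by linarith
  thus ?thesis using c_pos[of "Suc n"] by (simp add: zero_less_mult_iff)
qed

text \<open>If \<open>S\<close> vanished eventually, all coefficients would be 3 and the coordinates would decay or grow
  geometrically, contradicting \<open>c_sum\<close> or \<open>c_le_1\<close>.\<close>

lemma S_frequently_nonzero: "\<exists>n\<ge>n0. S n \<noteq> 0"
proof (rule ccontr)
  assume "\<not> ?thesis"
  hence z: "S n = 0" if "n \<ge> n0" for n using that by auto
  have k: "\<kappa> n = 3" if "n \<ge> n0" for n
    using z[of n] z[of "Suc n"] that by (simp add: S_def)
  have rec: "c (Suc (Suc n)) = 3 * c (Suc n) - c n" if "n \<ge> n0" for n
    using c_rec[of n] k[OF that] by simp
  have dec: "c (Suc n) < c n" if "n \<ge> n0" for n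
  proof (rule ccontr)
    assume "\<not> c (Suc n) < c n"
    hence le: "c n \<le> c (Suc n)" by simp
    have "c (Suc n) * 2 ^ i \<le> c (Suc n + i) \<and> c (n + i) \<le> c (Suc n + i)" for i
    proof (induction i)
      case (Suc i)
      thus ?case using rec[of "n + i"] that c_pos[of "Suc n + i"] by simp
    qed (use le in simp)
    hence "c (Suc n) * 2 ^ i \<le> 1" for i using c_le_1[of "Suc n + i"] by (meson order_trans)
    moreover obtain i where "1 / c (Suc n) < 2 ^ i" using real_arch_pow[of 2] by auto
    ultimately show False using c_pos[of "Suc n"] by (simp add: field_simps not_less[symmetric])
  qed
  have "c (Suc (Suc n0)) < c (Suc n0)" "c (Suc (Suc (Suc n0))) < c (Suc (Suc n0))"
    using dec[of "Suc n0"] dec[of "Suc (Suc n0)"] by auto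
  moreover have "3 * c (Suc (Suc n0)) = c (Suc n0) + c (Suc (Suc (Suc n0)))"
    using rec[of "Suc n0"] by simp
  ultimately have "2 * c (Suc (Suc n0)) < c (Suc n0)" by linarith
  hence "2 * c (Suc (Suc n0)) < 1" using c_le_1[of "Suc n0"] by linarith
  thus False using c_sum[of "Suc (Suc n0)"] dec[of "Suc (Suc n0)"] by simp
qed

section \<open>Lattice vectors and slopes along the orbit\<close>

fun v :: "nat \<Rightarrow> int \<times> int" where
  "v 0 = (1, 0)"
| "v (Suc 0) = (0, 1)"
| "v (Suc (Suc n)) = (\<kappa> n * fst (v (Suc n)) - fst (v n), \<kappa> n * snd (v (Suc n)) - snd (v n))"

abbreviation L :: "int \<times> int \<Rightarrow> real" where "L \<equiv> linear_form b a"

definition \<sigma> :: "nat \<Rightarrow> real" where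
  "\<sigma> n = of_int (snd (v n)) / c n"

lemma L_v: "L (v n) = c n"
proof (induction n rule: v.induct)
  case (3 n)
  have "L (v (Suc (Suc n))) = of_int (\<kappa> n) * L (v (Suc n)) - L (v n)"
    by (simp add: linear_form_def algebra_simps)
  thus ?case using 3 c_rec[of n] by simp
qed (simp_all add: linear_form_def c_0 c_1)

lemma det2_v: "det2 (v n) (v (Suc n)) = 1"
proof (induction n)
  case (Suc n)
  have "det2 (v (Suc n)) (v (Suc (Suc n))) = det2 (v n) (v (Suc n))"
    by (simp add: det2_def algebra_simps)
  thus ?case using Suc by simp
qed (simp add: det2_def)

lemma \<sigma>_Suc: "\<sigma> (Suc n) = \<sigma> n + b / (c n * c (Suc n))"
  using det2_linear_form[of b a "v n" "v (Suc n)"] c_pos[of n] c_pos[of "Suc n"]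
  by (simp add: \<sigma>_def L_v det2_v field_simps)

lemma c_prod_le_1: "c i * c j \<le> 1"
  using c_le_1[of i] c_le_1[of j] c_pos[of i] c_pos[of j] by (intro mult_le_one) auto

lemma \<sigma>_Suc_ge: "\<sigma> n + b \<le> \<sigma> (Suc n)"
proof -
  have "c n * c (Suc n) > 0" using c_pos by simp
  hence "b \<le> b / (c n * c (Suc n))"
    using c_prod_le_1[of n "Suc n"] ab by (simp add: field_simps)
  thus ?thesis by (simp add: \<sigma>_Suc)
qed

lemma \<sigma>_0: "\<sigma> 0 = 0" by (simp add: \<sigma>_def)

lemma \<sigma>_ge: "b * real n \<le> \<sigma> n"
proof (induction n)
  case (Suc n)
  thus ?case using \<sigma>_Suc_ge[of n] by (simp add: algebra_simps)
qed (simp add: \<sigma>_0)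

lemma \<sigma>_strict_mono: "strict_mono \<sigma>"
  unfolding strict_mono_Suc_iff using \<sigma>_Suc_ge ab by (smt (verit))

lemma \<sigma>_nonneg: "\<sigma> n \<ge> 0"
  using \<sigma>_ge[of n] ab by (smt (verit) mult_nonneg_nonneg of_nat_0_le_iff)

lemma snd_v_eq: "of_int (snd (v n)) = \<sigma> n * c n"
  using c_pos[of n] by (simp add: \<sigma>_def)

lemma S_eq:
  "real_of_int (S n) = (\<Sum>j<Suc n. edge_weight (c j) (c (Suc j))) + 3 - c 1 / c 0 - c n / c (Suc n)"
proof (induction n)
  case (Suc n)
  have "real_of_int (\<kappa> n) = c n / c (Suc n) + c (Suc (Suc n)) / c (Suc n)"
    using c_rec[of n] c_pos[of "Suc n"] by (simp add: field_simps)
  thus ?case using Suc by (simp add: S_def edge_weight_def)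
qed (simp add: S_def edge_weight_def)

lemma chain_weight_v: "chain_weight L v n = (\<Sum>j<n. edge_weight (c j) (c (Suc j)))"
  by (simp add: chain_weight_def L_v)

text \<open>The slope of \<open>u\<close> lies between two consecutive slopes \<sigma>_j <= t <
  \<sigma>_(j+1), so \<open>u\<close> has coordinates \<open>s >= 1\<close> and
  \<open>r >= 0\<close> in the basis of the two orbit vectors. If \<open>r\<close> were positive,
  \<open>L u\<close> would be at least \<open>c j + c (Suc j) > 1\<close>.\<close>

lemma strip_vector_in_orbit:
  assumes "0 < L u" "L u \<le> 1" "snd u \<ge> 0"
  obtains j s where "s \<ge> 1" "u = (s * fst (v j), s * snd (v j))"
proof -
  define t where "t = of_int (snd u) / L u"
  have t: "t \<ge> 0" using assms by (simp add: t_def)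
  have "\<exists>n. t < \<sigma> n"
  proof -
    obtain n where "t / b < real n" using reals_Archimedean2 by blast
    hence "t < b * real n" using ab by (simp add: field_simps)
    thus ?thesis using \<sigma>_ge[of n] by (meson less_le_trans)
  qed
  define n where "n = (LEAST n. t < \<sigma> n)"
  have n: "t < \<sigma> n" unfolding n_def by (rule LeastI_ex) fact
  hence "n \<noteq> 0" using t by (cases "n = 0") (auto simp: \<sigma>_0)
  then obtain j where j: "n = Suc j" by (cases n) auto
  have tj: "\<sigma> j \<le> t"
    using not_less_Least[of j "\<lambda>n. t < \<sigma> n"] j by (fold n_def) auto
  define s r where "s = det2 u (v (Suc j))" and "r = det2 (v j) u"
  have "of_int (snd u) * c (Suc j) < L u * of_int (snd (v (Suc j)))"
    using n j assms c_pos[of "Suc j"] by (simp add: t_def \<sigma>_def field_simps)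
  hence "b * of_int s > 0"
    using det2_linear_form[of b a u "v (Suc j)"] by (simp add: s_def L_v)
  hence s: "s \<ge> 1" using ab by (simp add: zero_less_mult_iff)
  have "of_int (snd (v j)) * L u \<le> c j * of_int (snd u)"
    using tj assms c_pos[of j] by (simp add: t_def \<sigma>_def field_simps)
  hence "b * of_int r \<ge> 0"
    using det2_linear_form[of b a "v j" u] by (simp add: r_def L_v)
  hence r: "r \<ge> 0" using ab by (simp add: zero_le_mult_iff)
  have Lu: "L u = of_int s * c j + of_int r * c (Suc j)"
    using linear_form_basis[OF det2_v[of j], of b a u] by (simp add: s_def r_def L_v)
  have "r = 0"
  proof (rule ccontr)
    assume "r \<noteq> 0"
    hence "1 * c (Suc j) \<le> of_int r * c (Suc j)"
      using r c_pos[of "Suc j"] by (intro mult_right_mono) auto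
    moreover have "1 * c j \<le> of_int s * c j" using s c_pos[of j] by (intro mult_right_mono) auto
    ultimately show False using c_sum[of j] assms(2) Lu by linarith
  qed
  have "of_int (fst u) = real_of_int (s * fst (v j))" "of_int (snd u) = real_of_int (s * snd (v j))"
    using linear_form_basis[OF det2_v[of j], of 1 0 u] linear_form_basis[OF det2_v[of j], of 0 1 u] \<open>r = 0\<close>
    by (simp_all add: linear_form_def s_def r_def)
  hence "u = (s * fst (v j), s * snd (v j))" by (metis of_int_eq_iff prod.collapse)
  thus thesis using that s by blast
qed

lemma primitive_strip_vector_in_orbit:
  assumes "0 < L u" "L u \<le> 1" "snd u \<ge> 0" "det2 u z = 1"
  obtains j where "u = v j"
proof -
  obtain j s where *: "s \<ge> 1" "u = (s * fst (v j), s * snd (v j))"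
    using strip_vector_in_orbit[OF assms(1-3)] .
  have "s * det2 (v j) z = 1" using assms(4) * by (simp add: det2_def algebra_simps)
  hence "s = 1"
    using *(1) by (metis abs_of_pos zmult_eq_1_iff not_one_le_zero abs_zmult_eq_1 zero_less_one_class.zero_less_one less_le_trans)
  thus thesis using that[of j] * by simp
qed

text \<open>A very small coordinate is preceded by an arithmetic progression of coordinates.  Hence it can
  only occur late, which gives the lower bound \<open>c_lower_bound\<close> without any Diophantine input.\<close>

lemma orbit_linear_before_small:
  assumes J: "(2 * real J + 1) * c (Suc J) < 1"
  shows "i \<le> J \<Longrightarrow> c (J - i) = c J - real i * c (Suc J)"
proof (induction i rule: less_induct)
  case (less i)
  define \<epsilon> where "\<epsilon> = c (Suc J)"
  have \<epsilon>: "\<epsilon> > 0" by (simp add: \<epsilon>_def c_pos)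
  show ?case
  proof (cases i)
    case (Suc i')
    define m where "m = J - i"
    have Sm: "Suc m = J - i'" using less.prems Suc by (simp add: m_def)
    have cn: "c (Suc m) = c J - real i' * \<epsilon>"
      using less.IH[of i'] less.prems Suc by (simp add: Sm \<epsilon>_def)
    \<comment> \<open>Read backwards, the recurrence involves \<open>c (Suc (Suc m))\<close>, which
      is \<epsilon> itself at the start and \<open>c (Suc m) + \<epsilon>\<close> later; in the
      second case the coefficient absorbs one \<open>c (Suc m)\<close>.\<close>
    obtain k :: int where k: "c m = of_int k * c (Suc m) - \<epsilon>"
    proof (cases i')
      case 0
      thus ?thesis using c_rec[of m] Sm by (intro that[of "\<kappa> m"]) (simp add: \<epsilon>_def)
    next
      case (Suc i'')
      hence "Suc (Suc m) = J - i''" using Sm less.prems \<open>i = Suc i'\<close> by simp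
      hence "c (Suc (Suc m)) = c (Suc m) + \<epsilon>"
        using cn less.IH[of i''] less.prems Suc \<open>i = Suc i'\<close>
          by (simp add: \<epsilon>_def algebra_simps)
      thus ?thesis using c_rec[of m]
        by (intro that[of "\<kappa> m - 1"]) (simp add: algebra_simps)
    qed
    have cm: "c (Suc m) > 0" by (rule c_pos)
    \<comment> \<open>The factor \<open>2 J + 1\<close> of the assumption is what makes
      \<open>c (Suc m)\<close> exceed \<open>(1 + \<epsilon>) / 2\<close>; as
      \<open>c m <= 1\<close>, this forces \<open>k = 1\<close>.\<close>
    have "c J > 1 - \<epsilon>" using c_sum[of J] by (simp add: \<epsilon>_def)
    moreover have "(2 * real i' + 3) * \<epsilon> \<le> (2 * real J + 1) * \<epsilon>"
      using less.prems Suc \<epsilon> by (intro mult_right_mono) auto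
    ultimately have "1 + \<epsilon> < 2 * c (Suc m)"
      using J by (simp add: cn \<epsilon>_def algebra_simps)
    hence "of_int k * c (Suc m) < 2 * c (Suc m)" using k c_le_1[of m] by linarith
    hence "k < 2" using cm by simp
    moreover have "of_int k * c (Suc m) > 0" using k c_pos[of m] \<epsilon> by linarith
    hence "k > 0" using cm by (simp add: zero_less_mult_iff)
    ultimately have "k = 1" by simp
    thus ?thesis using k cn Suc by (simp add: m_def \<epsilon>_def algebra_simps)
  qed simp
qed

lemma c_lower_bound:
  "\<exists>\<mu>>0. \<forall>j. \<mu> \<le> c j * real (Suc j)"
proof -
  \<comment> \<open>The entries \<open>a\<close> and \<open>b\<close> serve the first two
    coordinates and \<open>1 / 2\<close> those with \<open>(2 J + 1) c j >= 1\<close>. Any other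
    coordinate is the step of a progression reaching back to \<open>c 0 = b\<close> and
    \<open>c 1 = a\<close>, hence equals \<open>a - b\<close>.\<close>
  define \<mu> where "\<mu> = min (min (1 / 2) (min a b)) (if a > b then a - b else 1)"
  have "\<mu> > 0" using ab by (auto simp: \<mu>_def)
  have \<mu>: "\<mu> \<le> 1 / 2" "\<mu> \<le> a" "\<mu> \<le> b"
    "a > b \<Longrightarrow> \<mu> \<le> a - b" by (auto simp: \<mu>_def)
  moreover have "\<mu> \<le> c j * real (Suc j)" for j
  proof -
    have big: "\<mu> \<le> c j * real (Suc j)" if "\<mu> \<le> c j"
    proof -
      have "c j * 1 \<le> c j * real (Suc j)" using c_pos[of j] by (intro mult_left_mono) auto
      thus ?thesis using that by simp
    qed
    consider "j = 0" | "j = 1" | J where "j = Suc J" "J \<ge> 1"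
    proof (cases j)
      case (Suc J)
      thus ?thesis using that by (cases "J = 0") auto
    qed (use that in auto)
    thus ?thesis
    proof cases
      case 3
      show ?thesis
      proof (cases "(2 * real J + 1) * c j < 1")
        case True
        have "c (J - J) = c J - real J * c j" "c (J - (J - 1)) = c J - real (J - 1) * c j"
          using orbit_linear_before_small[of J J] orbit_linear_before_small[of J "J - 1"] True 3(1)
            by simp_all
        hence "c j = a - b" using 3(2) c_0 c_1 by (simp add: of_nat_diff algebra_simps)
        thus ?thesis using c_pos[of j] \<mu> by (intro big) auto
      next
        case False
        have "1 \<le> (2 * real J + 1) * c j" using False by simp
        also have "\<dots> \<le> (2 * real (Suc j)) * c j"
          using c_pos[of j] 3 by (intro mult_right_mono) auto
        finally show ?thesis using \<mu>(1) by (simp add: algebra_simps)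
      qed
    qed (use big \<mu> c_0 c_1 in auto)
  qed
  ultimately show ?thesis using \<open>\<mu> > 0\<close> by blast
qed

section \<open>Weight sums and the growth of the slopes\<close>

definition G :: "nat \<Rightarrow> real" where
  "G n = (\<Sum>j<n. edge_weight (c j) (c (Suc j)))"

text \<open>The increments of \<open>\<sigma>\<close> are controlled by the weights themselves, so the logarithmic bound on \<open>G\<close>
  yields \<open>\<sigma> n = n\<^bsup>1 + o(1)\<^esup>\<close>.\<close>

lemma \<sigma>_le_G: "\<sigma> n \<le> b * (2 * G n + 6 * real n)"
proof (induction n)
  case (Suc n)
  have "1 / (c n * c (Suc n)) \<le> 2 * edge_weight (c n) (c (Suc n)) + 6"
    using c_sum[of n] by (intro inverse_prod_le_edge_weight c_pos) simp
  hence "b * (1 / (c n * c (Suc n))) \<le> b * (2 * edge_weight (c n) (c (Suc n)) + 6)"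
    using ab by (intro mult_left_mono) auto
  thus ?case using Suc \<sigma>_Suc[of n] by (simp add: G_def algebra_simps)
qed (simp add: \<sigma>_0 G_def)

lemma v_height:
  assumes "n \<ge> 1"
  shows "snd (v n) \<ge> 1"
proof -
  have "\<sigma> 0 < \<sigma> n" using \<sigma>_strict_mono assms by (simp add: strict_mono_less)
  hence "real_of_int (snd (v n)) > 0" using c_pos[of n] by (simp add: \<sigma>_0 snd_v_eq)
  thus ?thesis by linarith
qed

lemma \<sigma>_ge_1:
  assumes "n \<ge> 1"
  shows "\<sigma> n \<ge> 1"
proof -
  have "1 \<le> real_of_int (snd (v n))" using v_height[OF assms] by simp
  also have "\<dots> = \<sigma> n * c n" by (rule snd_v_eq)
  also have "\<dots> \<le> \<sigma> n * 1"
    using c_le_1 \<sigma>_nonneg by (intro mult_left_mono) auto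
  finally show ?thesis by simp
qed

text \<open>As the chain starts at \<open>(1, 0)\<close>, heights relative to its first vertex are
  second coordinates. All vertices are orbit vectors of index at most \<open>n\<close>, so their
  slopes are at most \<open>\<sigma> n\<close>.\<close>

lemma reduced_orbit_chain:
  assumes "n \<ge> 1"
  obtains w r where "reduced w (Suc r)" "\<forall>p. det2 (w 0) p = snd p" "w (Suc r) = v n"
    "\<forall>i\<le>Suc r. \<exists>j\<le>n. w i = v j"
    "\<forall>i\<le>Suc r. L (w i) > 0 \<and> L (w i) \<le> 1 \<and> of_int (snd (w i)) \<le> \<sigma> n * L (w i) \<and> of_int (snd (w i)) \<le> \<sigma> n"
    "G n = (\<Sum>i<r. real_of_int (det2 (w i) (w (Suc (Suc i)))) - 3)
       + L (w 1) / L (w 0) + L (w r) / L (w (Suc r)) - 3"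
proof -
  have "chain v n" using det2_v by (simp add: chain_def)
  moreover have "L (v i) > 0" for i by (simp add: L_v c_pos)
  ultimately obtain w r where *: "reduced w r" "r \<ge> 1" "w 0 = v 0" "w r = v n"
    "w ` {..r} \<subseteq> v ` {..n}"
    "chain_weight L w r = chain_weight L v n"
    using reduced_subchain[of v n b a] assms by auto
  obtain q where q: "r = Suc q" using *(2) by (cases r) auto
  have orb: "\<exists>j\<le>n. w i = v j" if "i \<le> r" for i
    using *(5) that by force
  have bnd:
    "L (w i) > 0 \<and> L (w i) \<le> 1 \<and> of_int (snd (w i)) \<le> \<sigma> n * L (w i) \<and> of_int (snd (w i)) \<le> \<sigma> n"
    if i: "i \<le> r" for i
  proof -
    obtain j where j: "j \<le> n" "w i = v j" using orb[OF i] by auto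
    have "\<sigma> j \<le> \<sigma> n"
      using \<sigma>_strict_mono j(1) by (simp add: strict_mono_less_eq)
    hence 1: "\<sigma> j * c j \<le> \<sigma> n * c j" using c_pos[of j] by simp
    also have "\<dots> \<le> \<sigma> n * 1"
      using \<sigma>_nonneg c_le_1 by (intro mult_left_mono) auto
    finally show ?thesis using 1 c_pos[of j] c_le_1[of j] by (simp add: j L_v snd_v_eq)
  qed
  have "G n = (\<Sum>i<q. real_of_int (det2 (w i) (w (Suc (Suc i)))) - 3)
       + L (w 1) / L (w 0) + L (w q) / L (w (Suc q)) - 3"
    using chain_weight_eq_sum[OF *(1), of b a q] bnd *(6) q by (simp add: chain_weight_v G_def)
  thus thesis using that[of w q] * bnd orb q by (simp add: det2_def)
qed

text \<open>A coefficient times the value at its vertex is a sum of two values in (0, 1], so it is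
  at most \<open>2 P\<close>; inner vertices have positive height and thus are not
  \<open>v 0\<close>. The terms \<open>1 / b\<close> and \<open>P\<close> bound the two boundary
  fractions.\<close>

lemma G_upper:
  assumes n: "n \<ge> 1" and P:
    "\<And>j. 1 \<le> j \<Longrightarrow> j \<le> n \<Longrightarrow> 1 / c j \<le> P"
  shows "G n \<le> 2 * P * log 2 (\<sigma> n) + 1 / b + P"
proof -
  obtain w r where w': "reduced w (Suc r)" "\<forall>p. det2 (w 0) p = snd p" "w (Suc r) = v n"
    "\<forall>i\<le>Suc r. \<exists>j\<le>n. w i = v j"
    "\<forall>i\<le>Suc r. L (w i) > 0 \<and> L (w i) \<le> 1 \<and> of_int (snd (w i)) \<le> \<sigma> n * L (w i) \<and> of_int (snd (w i)) \<le> \<sigma> n"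
    "G n = (\<Sum>i<r. real_of_int (det2 (w i) (w (Suc (Suc i)))) - 3)
       + L (w 1) / L (w 0) + L (w r) / L (w (Suc r)) - 3"
    using reduced_orbit_chain[OF n] .
  note w = w'[rule_format]
  have P1: "1 / L (w i) \<le> P" if i: "1 \<le> i" "i \<le> Suc r" for i
  proof -
    obtain j where j: "j \<le> n" "w i = v j" using w(4) i by blast
    have "snd (w i) \<ge> 1" using reduced_height_pos[OF w(1)] i w(2) by simp
    hence "j \<ge> 1" using j by (cases j) auto
    thus ?thesis using P[of j] j by (simp add: L_v)
  qed
  have "0 < 1 / c n" using c_pos[of n] by simp
  hence Ppos: "P > 0" using P[of n] n by linarith
  have "real_of_int (det2 (w i) (w (Suc (Suc i)))) \<le> 2 * P" if i: "Suc i < Suc r" for i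
  proof -
    have "of_int (det2 (w i) (w (Suc (Suc i)))) * L (w (Suc i)) \<le> 2"
      using reduced_linear_form[OF w(1) i, of b a] w(5)[of i] w(5)[of "Suc (Suc i)"] i by linarith
    hence "real_of_int (det2 (w i) (w (Suc (Suc i)))) \<le> 2 * (1 / L (w (Suc i)))"
      using w(5)[of "Suc i"] i by (simp add: field_simps)
    thus ?thesis using P1[of "Suc i"] i by simp
  qed
  hence "(\<Sum>i<r. real_of_int (det2 (w i) (w (Suc (Suc i)))) - 3) \<le> 2 * P * log 2 (real_of_int (snd (v n)))"
    using reduced_sum_upper[OF w(1), of "2 * P" r] Ppos w(2,3) by simp
  also have "\<dots> \<le> 2 * P * log 2 (\<sigma> n)"
    using w(5)[of "Suc r"] w(3) v_height[OF n] Ppos by (intro mult_left_mono) auto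
  finally have 1:
    "(\<Sum>i<r. real_of_int (det2 (w i) (w (Suc (Suc i)))) - 3) \<le> 2 * P * log 2 (\<sigma> n)" .
  have "L (w 1) / L (w 0) \<le> 1 / L (w 0)" "L (w r) / L (w (Suc r)) \<le> 1 / L (w (Suc r))"
    using w(5)[of 0] w(5)[of 1] w(5)[of r] w(5)[of "Suc r"] by (auto intro!: divide_right_mono)
  moreover have "L (w 0) = b"
  proof -
    obtain j where j: "w 0 = v j" using w(4)[of 0] by auto
    have "snd (w 0) = 0" using w(2)[of "w 0"] by simp
    hence "j = 0" using v_height[of j] j by (cases j) auto
    thus ?thesis using j by (simp add: linear_form_def)
  qed
  ultimately show ?thesis using 1 w(6) P1[of "Suc r"] by simp
qed

text \<open>Only coefficients 2 contribute negatively. The premises on \<open>p\<close>,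
  \<open>u\<close>, \<open>m\<close> collect what is known about a run
  \<open>p, p + u, ..., p + m u\<close> of the reduced chain: its ends lie in the strip and the
  final slope is at most \<open>\<sigma> n\<close>.\<close>

lemma G_lower:
  assumes n: "n \<ge> 1"
    and Q: "\<And>p u m. \<lbrakk>det2 p u = 1; snd p \<ge> 0; snd u \<ge> 1; m \<ge> 1; 0 < L p; 0 < L p + real m * L u; L p + real m * L u \<le> 1;
      of_int (snd p) + real m * of_int (snd u) \<le> \<sigma> n * (L p + real m * L u)\<rbrakk> \<Longrightarrow> real m \<le> Q"
  shows "G n \<ge> - (Q + Q * log 2 (\<sigma> n)) - 3"
proof -
  obtain w r where w': "reduced w (Suc r)" "\<forall>p. det2 (w 0) p = snd p" "w (Suc r) = v n"
    "\<forall>i\<le>Suc r. \<exists>j\<le>n. w i = v j"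
    "\<forall>i\<le>Suc r. L (w i) > 0 \<and> L (w i) \<le> 1 \<and> of_int (snd (w i)) \<le> \<sigma> n * L (w i) \<and> of_int (snd (w i)) \<le> \<sigma> n"
    "G n = (\<Sum>i<r. real_of_int (det2 (w i) (w (Suc (Suc i)))) - 3)
       + L (w 1) / L (w 0) + L (w r) / L (w (Suc r)) - 3"
    using reduced_orbit_chain[OF n] .
  note w = w'[rule_format]
  have run: "real m \<le> Q" if m: "m \<ge> 1" "i + m \<le> Suc r"
    and two: "\<And>t. Suc t < m \<Longrightarrow> det2 (w (i + t)) (w (i + Suc (Suc t))) = 2"
      for i m
  proof -
    define u where "u = (fst (w (Suc i)) - fst (w i), snd (w (Suc i)) - snd (w i))"
    have u:
      "linear_form \<alpha> \<beta> u = linear_form \<alpha> \<beta> (w (Suc i)) - linear_form \<alpha> \<beta> (w i)" for \<alpha> \<beta>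
      by (simp add: u_def linear_form_def algebra_simps)
    have eq:
      "linear_form \<alpha> \<beta> (w (i + m)) = linear_form \<alpha> \<beta> (w i) + real m * linear_form \<alpha> \<beta> u" for \<alpha> \<beta>
      using reduced_run[OF w(1) m(2) two, of m] by (simp add: u)
    have "det2 (w i) (w (Suc i)) = 1" using w(1) m by (auto simp: reduced_def chain_def)
    hence d: "det2 (w i) u = 1" by (simp add: u_def det2_def algebra_simps)
    have h: "snd u \<ge> 1" "snd (w i) \<ge> 0"
      using reduced_height_Suc[OF w(1), of i] m w(2) by (auto simp: u_def)
    have "of_int (snd (w (i + m))) = real_of_int (snd (w i)) + real m * of_int (snd u)"
      using eq[of 0 1] by (simp add: linear_form_def)
    thus ?thesis using Q[OF d h(2,1) m(1)] eq[of b a] w(5)[of i] w(5)[of "i + m"] m by simp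
  qed
  define T where "T = card {i. i < r \<and> det2 (w i) (w (Suc (Suc i))) = 2}"
  have "Q \<ge> 1" using run[of 1 0] by simp
  have "real T \<le> Q + Q * log 2 (real_of_int (snd (v n)))"
    using reduced_count_twos[OF w(1), of Q r] run w(2,3) by (simp add: T_def)
  also have "\<dots> \<le> Q + Q * log 2 (\<sigma> n)"
    using w(5)[of "Suc r"] w(3) v_height[OF n] \<open>Q \<ge> 1\<close>
      by (intro add_left_mono mult_left_mono) auto
  finally have "real T \<le> Q + Q * log 2 (\<sigma> n)" .
  moreover have "L (w 1) / L (w 0) \<ge> 0" "L (w r) / L (w (Suc r)) \<ge> 0"
    using w(5)[of 0] w(5)[of 1] w(5)[of r] w(5)[of "Suc r"] by auto
  moreover have "- real T \<le> (\<Sum>i<r. real_of_int (det2 (w i) (w (Suc (Suc i)))) - 3)"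
    using reduced_sum_lower[OF w(1), of r] by (simp add: T_def)
  ultimately show ?thesis using w(6) by linarith
qed

text \<open>A bootstrap: with the a priori bound on \<open>1 / c j\<close>, the slope is at most of
  order \<open>n (1 + log \<sigma>_n)\<close>. The logarithm is absorbed into
  \<open>\<sigma> n powr \<eta>\<close>, which is divided out and leaves the power
  \<open>1 - \<eta>\<close> on the left.\<close>

lemma \<sigma>_growth:
  assumes "0 < \<eta>" "\<eta> < 1"
  obtains C where "C > 0"
    "\<And>n. n \<ge> 1 \<Longrightarrow> \<sigma> n \<le> C * real (Suc n) powr (1 / (1 - \<eta>))"
proof -
  obtain \<mu> where \<mu>: "\<mu> > 0" "\<And>j. \<mu> \<le> c j * real (Suc j)"
    using c_lower_bound by blast
  define D where "D = 4 / \<mu> + 2 / b + 6"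
  define E where "E = 1 + 1 / (\<eta> * ln 2)"
  have D: "D > 0" using \<mu> ab by (simp add: D_def add_pos_pos)
  have E: "E > 0" using assms by (simp add: E_def add_pos_pos)
  show thesis
  proof (rule that)
    show "(D * E) powr (1 / (1 - \<eta>)) > 0" using D E by simp
    fix n :: nat assume n: "n \<ge> 1"
    define P where "P = real (Suc n) / \<mu>"
    have P: "P > 0" using \<mu> by (simp add: P_def)
    have lg: "log 2 (\<sigma> n) \<ge> 0" using \<sigma>_ge_1[OF n] by simp
    have "1 / c j \<le> P" if "j \<le> n" for j
    proof -
      have "\<mu> \<le> c j * real (Suc j)" by (rule \<mu>(2))
      also have "\<dots> \<le> c j * real (Suc n)"
        using c_pos[of j] that by (intro mult_left_mono) auto
      finally show ?thesis using \<mu>(1) c_pos[of j] by (simp add: P_def field_simps)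
    qed
    hence G: "G n \<le> 2 * P * log 2 (\<sigma> n) + 1 / b + P" by (intro G_upper n) auto
    have "\<sigma> n \<le> b * (2 * G n + 6 * real n)" by (rule \<sigma>_le_G)
    also have "\<dots> \<le> b * (2 * (2 * P * log 2 (\<sigma> n) + 1 / b + P) + 6 * real n)"
      using G ab by (intro mult_left_mono) auto
    also have "\<dots> \<le> 1 * (2 * (2 * P * log 2 (\<sigma> n) + 1 / b + P) + 6 * real n)"
      using P lg ab by (intro mult_right_mono) auto
    also have "\<dots> = 4 * P * log 2 (\<sigma> n) + 2 * P + 2 / b + 6 * real n" by simp
    also have "\<dots> \<le> D * real (Suc n) * (1 + log 2 (\<sigma> n))"
    proof -
      define B l where "B = 1 / b" and "l = log 2 (\<sigma> n)"
      have "D * real (Suc n) = 4 * P + (2 * B + 6) * real (Suc n)"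
        by (simp add: D_def P_def B_def algebra_simps)
      hence "D * real (Suc n) * (1 + l) = (4 * P + (2 * B + 6) * real (Suc n)) * (1 + l)" by simp
      also have "\<dots> = 4 * P * l + 2 * P + 2 * B + 6 * real n
          + (2 * P + 2 * B * real n + 6 + (2 * B + 6) * real (Suc n) * l)"
        by (simp add: algebra_simps)
      also have "\<dots> \<ge> 4 * P * l + 2 * P + 2 * B + 6 * real n + 0"
        using P ab lg
          by (intro add_left_mono add_nonneg_nonneg mult_nonneg_nonneg) (auto simp: B_def l_def)
      finally show ?thesis by (simp add: B_def l_def)
    qed
    also have "\<dots> \<le> D * real (Suc n) * (E * \<sigma> n powr \<eta>)"
      unfolding E_def
        using D assms \<sigma>_ge_1[OF n] by (intro mult_left_mono one_plus_log2_le_powr) auto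
    finally have "\<sigma> n \<le> D * E * real (Suc n) * \<sigma> n powr \<eta>"
      by (simp add: mult_ac)
    moreover have "\<sigma> n = \<sigma> n powr (1 - \<eta>) * \<sigma> n powr \<eta>"
      using \<sigma>_ge_1[OF n] by (simp flip: powr_add)
    ultimately have
      "\<sigma> n powr (1 - \<eta>) * \<sigma> n powr \<eta> \<le> (D * E * real (Suc n)) * \<sigma> n powr \<eta>" by simp
    hence "\<sigma> n powr (1 - \<eta>) \<le> D * E * real (Suc n)"
      using \<sigma>_ge_1[OF n] by (subst (asm) mult_le_cancel_right) auto
    hence "(\<sigma> n powr (1 - \<eta>)) powr (1 / (1 - \<eta>)) \<le> (D * E * real (Suc n)) powr (1 / (1 - \<eta>))"
      using assms by (intro powr_mono2) auto
    thus "\<sigma> n \<le> (D * E) powr (1 / (1 - \<eta>)) * real (Suc n) powr (1 / (1 - \<eta>))"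
      using assms \<sigma>_ge_1[OF n] D E by (simp add: powr_powr powr_mult)
  qed
qed

section \<open>From Diophantine exponents to gaps of the linear form\<close>

abbreviation s :: real where "s \<equiv> b / a"

lemma L_nonzero:
  assumes "snd u \<noteq> 0"
  shows "L u \<noteq> 0"
proof
  assume "L u = 0"
  hence "of_int (fst u) * s = - of_int (snd u)" using ab by (simp add: linear_form_def field_simps)
  moreover from this have "fst u \<noteq> 0" using assms by auto
  ultimately have "s = - of_int (snd u) / of_int (fst u)" by (simp add: field_simps)
  thus False using irrational by (metis Rats_divide Rats_minus_iff Rats_of_int)
qed

text \<open>With \<open>p = - fst u\<close> the form is \<open>a p (snd u / p - s)\<close>, so the
  gap for fractions applies. Values of modulus below \<open>a\<close> force \<open>p >= 1\<close>
  and \<open>p <= (2 a / b) snd u\<close>; this turns denominators into heights and explains the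
  second entry of \<open>k\<close>.\<close>

lemma linear_form_gap:
  assumes sg: "sg = 1 \<or> sg = - 1" and fin: "finite (approximants sg s e)" and e: "e \<ge> 1"
  obtains k where "k > 0"
    "\<And>u. \<lbrakk>snd u \<ge> 1; 0 < of_int sg * L u\<rbrakk> \<Longrightarrow>
    k * of_int (snd u) powr (1 - e) \<le> of_int sg * L u"
proof -
  obtain \<delta> where \<delta>: "\<delta> > 0"
    "\<And>p q. \<lbrakk>p \<ge> 1; 0 < of_int sg * (of_int q / of_int p - s)\<rbrakk> \<Longrightarrow>
    \<delta> * of_int p powr (- e) \<le> of_int sg * (of_int q / of_int p - s)"
    using approximants_gap[OF fin] e by auto
  define k where "k = min a (a * \<delta> * (2 * a / b) powr (1 - e))"
  show thesis
  proof (rule that)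
    show "k > 0" using ab \<delta> by (simp add: k_def)
    fix u :: "int \<times> int" assume h: "snd u \<ge> 1" and pos: "0 < of_int sg * L u"
    define h where "h = real_of_int (snd u)"
    have h1: "h \<ge> 1" using \<open>snd u \<ge> 1\<close> by (simp add: h_def)
    have "h powr (1 - e) \<le> 1" using h1 e powr_mono[of "1 - e" 0 h] by simp
    show "k * of_int (snd u) powr (1 - e) \<le> of_int sg * L u"
    proof (cases "a \<le> of_int sg * L u")
      case True
      have "k * h powr (1 - e) \<le> a * 1"
        using \<open>h powr (1 - e) \<le> 1\<close> ab by (intro mult_mono) (auto simp: k_def)
      thus ?thesis using True by (simp add: h_def)
    next
      case False
      have "fst u < 0"
      proof (rule ccontr)
        assume "\<not> fst u < 0"
        hence "0 \<le> of_int (fst u) * b" using ab by (intro mult_nonneg_nonneg) auto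
        moreover have "1 * a \<le> h * a" using h1 ab by (intro mult_right_mono) auto
        ultimately have "L u \<ge> a" by (simp add: linear_form_def h_def)
        thus False using False pos sg ab by auto
      qed
      define p where "p = - fst u"
      have p: "p \<ge> 1" using \<open>fst u < 0\<close> by (simp add: p_def)
      have Lp: "L u = a * of_int p * (of_int (snd u) / of_int p - s)"
        using p ab by (simp add: linear_form_def p_def field_simps)
      have sgL: "of_int sg * L u = a * of_int p * (of_int sg * (of_int (snd u) / of_int p - s))"
        unfolding Lp by simp
      have "0 < a * of_int p * (of_int sg * (of_int (snd u) / of_int p - s))"
        using pos unfolding sgL .
      moreover have "0 < a * of_int p" using ab p by simp
      ultimately have "0 < of_int sg * (of_int (snd u) / of_int p - s)" by (rule zero_less_mult_pos)
      hence "\<delta> * of_int p powr (- e) \<le> of_int sg * (of_int (snd u) / of_int p - s)"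
        using p by (intro \<delta>(2))
      hence "a * of_int p * (\<delta> * of_int p powr (- e)) \<le> of_int sg * L u"
        unfolding sgL using p ab by (intro mult_left_mono) auto
      moreover have "of_int p * of_int p powr (- e) = (of_int p :: real) powr (1 - e)"
        using p by (simp add: powr_diff powr_minus_divide)
      ultimately have 1: "a * \<delta> * of_int p powr (1 - e) \<le> of_int sg * L u"
        by (simp add: mult_ac)
      have "\<bar>L u\<bar> < a" using False pos sg by auto
      hence "of_int p * b \<le> a * h + a" by (simp add: linear_form_def p_def h_def algebra_simps)
      also have "\<dots> \<le> 2 * a * h" using h1 ab by simp
      finally have "of_int p \<le> (2 * a / b) * h" using ab by (simp add: field_simps)
      hence "((2 * a / b) * h) powr (1 - e) \<le> of_int p powr (1 - e)"
        using p e by (intro powr_mono2') auto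
      hence "a * \<delta> * ((2 * a / b) powr (1 - e) * h powr (1 - e)) \<le> a * \<delta> * of_int p powr (1 - e)"
        using ab \<delta>(1) h1 by (intro mult_left_mono) (auto simp: powr_mult[symmetric])
      moreover have
        "k * h powr (1 - e) \<le> (a * \<delta> * (2 * a / b) powr (1 - e)) * h powr (1 - e)"
        by (intro mult_right_mono) (auto simp: k_def)
      ultimately show ?thesis using 1 by (simp add: h_def mult_ac)
    qed
  qed
qed

section \<open>The upper bound\<close>

text \<open>The two conditions express \<open>(e\<^sup>+ - 1) / e\<^sup>+ < \<theta>\<close> and \<open>(e\<^sup>- - 2) / e\<^sup>- < \<theta>\<close> in the form in which
  they are applied: \<open>x\<close> is a coefficient or the length of a run, and \<open>x h\<close> (resp. \<open>x h\<^sup>2\<close>) is at most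
  the slope reached
    by it.  For \<open>\<theta> = 1\<close> they hold trivially, which covers infinite exponents.\<close>

definition upper_gap :: "real \<Rightarrow> bool" where
  "upper_gap \<theta> \<longleftrightarrow> (\<exists>C>0. \<forall>u x. 0 < L u \<longrightarrow> snd u \<ge> 1 \<longrightarrow> 0 < x \<longrightarrow> x * L u \<le> 1 \<longrightarrow>
     x \<le> C * (x * of_int (snd u)) powr \<theta>)"

definition lower_gap :: "real \<Rightarrow> bool" where
  "lower_gap \<theta> \<longleftrightarrow> (\<exists>C>0. \<forall>u x. L u < 0 \<longrightarrow> snd u \<ge> 1 \<longrightarrow> 0 < x \<longrightarrow>
     x * - L u * of_int (snd u) \<le> 1 \<longrightarrow> x \<le> C * (x * (of_int (snd u))\<^sup>2) powr \<theta>)"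

lemma gap_interpolation:
  fixes x k y \<theta> :: real
  assumes "x > 0" "k > 0" "y > 0" "\<theta> < 1" "x powr (1 - \<theta>) \<le> k * y powr \<theta>"
  shows "x \<le> k * (x * y) powr \<theta>"
proof -
  have "x = x powr (1 - \<theta>) * x powr \<theta>" using assms(1) by (simp flip: powr_add)
  also have "\<dots> \<le> (k * y powr \<theta>) * x powr \<theta>"
    using assms by (intro mult_right_mono) auto
  finally show ?thesis using assms by (simp add: powr_mult mult_ac)
qed

lemma upper_gap_of_exponent:
  assumes "\<theta> = 1 \<or> exponent_ratio 1 (even_exponent s) < ereal \<theta>" "0 < \<theta>"
    "\<theta> \<le> 1"
  shows "upper_gap \<theta>"
proof (cases "\<theta> = 1")
  case True
  have "x \<le> 1 * (x * of_int (snd u)) powr \<theta>" if "snd u \<ge> 1" "0 < x"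
    for u :: "int \<times> int" and x :: real
  proof -
    have "x * 1 \<le> x * of_int (snd u)" using that by (intro mult_left_mono) auto
    thus ?thesis using that True by simp
  qed
  thus ?thesis unfolding upper_gap_def by (intro exI[of _ 1]) auto
next
  case False
  hence \<theta>: "\<theta> < 1" using assms by simp
  note ratio = assms(1)[simplified False simp_thms]
  have ge1: "even_exponent s \<ge> 1" unfolding even_exponent_eq
    by (intro side_exponent_ge_1 irrational) simp
  \<comment> \<open>An infinite exponent has ratio 1, which is not below \<theta>.\<close>
  obtain r where r: "even_exponent s = ereal r" "r \<ge> 1"
    using ge1 ratio \<theta>
      by (cases "even_exponent s") (auto simp: exponent_ratio_def one_ereal_def)
  \<comment> \<open>The solution of \<open>\<theta> = (e - 1) / e\<close>. It gives
    \<open>x <= 1 / L u\<close>, hence at most of order \<open>h powr (e - 1)\<close>, and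
    \<open>(e - 1) (1 - \<theta>) = \<theta>\<close>.\<close>
  define e where "e = 1 / (1 - \<theta>)"
  have "(r - 1) / r < \<theta>" using ratio r by (simp add: exponent_ratio_def)
  hence "r < e" using r \<theta> by (simp add: e_def field_simps)
  hence "finite (approximants 1 s e)"
    using r even_exponent_eq[of s] by (intro finite_approximants) auto
  moreover have e1: "e \<ge> 1" using \<theta> assms by (simp add: e_def)
  ultimately obtain k where k: "k > 0"
    "\<And>u. \<lbrakk>snd u \<ge> 1; 0 < of_int 1 * L u\<rbrakk> \<Longrightarrow>
    k * of_int (snd u) powr (1 - e) \<le> of_int 1 * L u"
    using linear_form_gap[of 1 e] by auto
  have e\<theta>: "(e - 1) * (1 - \<theta>) = \<theta>"
    using \<theta> by (simp add: e_def field_simps)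
  have "x \<le> (1 / k) powr (1 - \<theta>) * (x * of_int (snd u)) powr \<theta>"
    if u: "0 < L u" "snd u \<ge> 1" "0 < x" "x * L u \<le> 1" for u x
  proof (rule gap_interpolation)
    define h where "h = real_of_int (snd u)"
    have h: "h \<ge> 1" using u by (simp add: h_def)
    have "k * h powr (1 - e) * x \<le> L u * x"
      using k(2)[of u] u by (intro mult_right_mono) (auto simp: h_def)
    moreover have "L u * x \<le> 1" using u by (simp add: mult.commute)
    ultimately have "k * h powr (1 - e) * x \<le> 1" by linarith
    moreover have "h powr (1 - e) = 1 / h powr (e - 1)" by (simp flip: powr_minus_divide)
    ultimately have "x \<le> (1 / k) * h powr (e - 1)" using k(1) h by (simp add: field_simps)
    hence "x powr (1 - \<theta>) \<le> ((1 / k) * h powr (e - 1)) powr (1 - \<theta>)"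
      using u \<theta> by (intro powr_mono2) auto
    also have "\<dots> = (1 / k) powr (1 - \<theta>) * h powr \<theta>"
      using k(1) by (subst powr_mult) (simp_all add: powr_powr e\<theta>)
    finally show "x powr (1 - \<theta>) \<le> (1 / k) powr (1 - \<theta>) * of_int (snd u) powr \<theta>" by (simp add: h_def)
  qed (use u k \<theta> in auto)
  thus ?thesis unfolding upper_gap_def
    using k(1) by (intro exI[of _ "(1 / k) powr (1 - \<theta>)"]) auto
qed

lemma lower_gap_of_exponent:
  assumes "\<theta> = 1 \<or> exponent_ratio 2 (odd_exponent s) < ereal \<theta>" "0 < \<theta>"
    "\<theta> \<le> 1"
  shows "lower_gap \<theta>"
proof (cases "\<theta> = 1")
  case True
  have "x \<le> 1 * (x * (of_int (snd u))\<^sup>2) powr \<theta>" if "snd u \<ge> 1" "0 < x"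
    for u :: "int \<times> int" and x :: real
  proof -
    have "x * 1 \<le> x * (of_int (snd u))\<^sup>2"
      using that by (intro mult_left_mono one_le_power) auto
    thus ?thesis using that True by simp
  qed
  thus ?thesis unfolding lower_gap_def by (intro exI[of _ 1]) auto
next
  case False
  hence \<theta>: "\<theta> < 1" using assms by simp
  note ratio = assms(1)[simplified False simp_thms]
  have ge1: "odd_exponent s \<ge> 1" unfolding odd_exponent_eq
    by (intro side_exponent_ge_1 irrational) simp
  obtain r where r: "odd_exponent s = ereal r" "r \<ge> 1"
    using ge1 ratio \<theta>
      by (cases "odd_exponent s") (auto simp: exponent_ratio_def one_ereal_def)
  \<comment> \<open>The solution of \<open>\<theta> = (e - 2) / e\<close>. Here \<open>x\<close> is
    at most \<open>1 / (h * - L u)\<close>; the additional factor \<open>h\<close> accounts for the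
    2.\<close>
  define e where "e = 2 / (1 - \<theta>)"
  have "(r - 2) / r < \<theta>" using ratio r by (simp add: exponent_ratio_def)
  hence "r < e" using r \<theta> by (simp add: e_def field_simps)
  hence "finite (approximants (- 1) s e)"
    using r odd_exponent_eq[of s] by (intro finite_approximants) auto
  moreover have e1: "e \<ge> 1" using \<theta> assms by (simp add: e_def)
  ultimately obtain k where k: "k > 0"
    "\<And>u. \<lbrakk>snd u \<ge> 1; 0 < of_int (- 1) * L u\<rbrakk> \<Longrightarrow>
    k * of_int (snd u) powr (1 - e) \<le> of_int (- 1) * L u"
    using linear_form_gap[of "- 1" e] by auto
  have e\<theta>: "(e - 2) * (1 - \<theta>) = 2 * \<theta>"
    using \<theta> by (simp add: e_def field_simps)
  have "x \<le> (1 / k) powr (1 - \<theta>) * (x * (of_int (snd u))\<^sup>2) powr \<theta>"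
    if u: "L u < 0" "snd u \<ge> 1" "0 < x" "x * - L u * of_int (snd u) \<le> 1" for u x
  proof (rule gap_interpolation)
    define h where "h = real_of_int (snd u)"
    have h: "h \<ge> 1" using u by (simp add: h_def)
    have "k * h powr (1 - e) * (x * h) \<le> - L u * (x * h)"
      using k(2)[of u] u h by (intro mult_right_mono) (auto simp: h_def)
    moreover have "- L u * (x * h) \<le> 1" using u(4) by (simp add: h_def mult_ac)
    ultimately have "k * x * (h powr (1 - e) * h) \<le> 1" by (simp add: mult_ac)
    moreover have "h powr (1 - e) * h = 1 / h powr (e - 2)"
      using h by (simp add: powr_diff powr_minus_divide field_simps power2_eq_square)
    ultimately have "k * x * (1 / h powr (e - 2)) \<le> 1" by simp
    hence "x \<le> (1 / k) * h powr (e - 2)" using k(1) h by (simp add: field_simps)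
    hence "x powr (1 - \<theta>) \<le> ((1 / k) * h powr (e - 2)) powr (1 - \<theta>)"
      using u \<theta> by (intro powr_mono2) auto
    also have "\<dots> = (1 / k) powr (1 - \<theta>) * h powr (2 * \<theta>)"
      using k(1) by (subst powr_mult) (simp_all add: powr_powr e\<theta>)
    also have "h powr (2 * \<theta>) = (h\<^sup>2) powr \<theta>" using h by (simp flip: powr_powr)
    finally show "x powr (1 - \<theta>) \<le> (1 / k) powr (1 - \<theta>) * ((of_int (snd u))\<^sup>2) powr \<theta>" by (simp add: h_def)
  qed (use u k \<theta> in auto)
  thus ?thesis unfolding lower_gap_def
    using k(1) by (intro exI[of _ "(1 / k) powr (1 - \<theta>)"]) auto
qed

text \<open>A single number \<open>P\<close> of order \<open>\<sigma> N powr \<theta>\<close> bounds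
  both the inverse coordinates and the lengths of runs, so both logarithmic counts apply with
  it.\<close>

lemma S_bound_\<sigma>:
  assumes gaps: "upper_gap \<theta>" "lower_gap \<theta>" and \<theta>: "0 < \<theta>"
  obtains C where "C > 0"
    "\<And>n. \<bar>real_of_int (S n)\<bar> \<le> C * \<sigma> (Suc n) powr \<theta> * (1 + log 2 (\<sigma> (Suc n)))"
proof -
  obtain C1 where C1: "C1 > 0"
    "\<And>u x. \<lbrakk>0 < L u; snd u \<ge> 1; 0 < x; x * L u \<le> 1\<rbrakk> \<Longrightarrow>
     x \<le> C1 * (x * of_int (snd u)) powr \<theta>"
    using gaps(1) unfolding upper_gap_def by blast
  obtain C2 where C2: "C2 > 0"
    "\<And>u x. \<lbrakk>L u < 0; snd u \<ge> 1; 0 < x; x * - L u * of_int (snd u) \<le> 1\<rbrakk> \<Longrightarrow>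
     x \<le> C2 * (x * (of_int (snd u))\<^sup>2) powr \<theta>"
    using gaps(2) unfolding lower_gap_def by blast
  define C where "C = max C1 C2"
  have C: "C > 0" "C1 \<le> C" "C2 \<le> C" using C1 by (auto simp: C_def)
  show thesis
  proof (rule that)
    show "2 * C + 1 / b + 3 > 0" using C ab by (simp add: add_pos_pos)
    fix n
    define N where "N = Suc n"
    have N: "N \<ge> 1" by (simp add: N_def)
    have \<sigma>1: "\<sigma> N \<ge> 1" by (rule \<sigma>_ge_1[OF N])
    define P where "P = C * \<sigma> N powr \<theta>"
    define l where "l = log 2 (\<sigma> N)"
    have l: "l \<ge> 0" using \<sigma>1 by (simp add: l_def)
    have \<sigma>\<theta>: "\<sigma> N powr \<theta> \<ge> 1"
      using \<sigma>1 \<theta> by (simp add: ge_one_powr_ge_zero)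
    have P: "P > 0" using C \<sigma>1 by (simp add: P_def)
    have toP: "x \<le> P"
      if "x \<le> C' * y powr \<theta>" "C' \<le> C" "0 \<le> y" "y \<le> \<sigma> N" for x y C'
    proof -
      have "C' * y powr \<theta> \<le> C * \<sigma> N powr \<theta>"
        using that \<theta> C by (intro mult_mono powr_mono2) auto
      thus ?thesis using that(1) by (simp add: P_def)
    qed
    have inv: "1 / c j \<le> P" if j: "1 \<le> j" "j \<le> N" for j
    proof (rule toP)
      \<comment> \<open>For \<open>x = 1 / c j\<close> the product of \<open>x\<close> and the
        height is the slope \<open>\<sigma> j\<close>.\<close>
      show "1 / c j \<le> C1 * (1 / c j * of_int (snd (v j))) powr \<theta>"
        using c_pos[of j] v_height[OF j(1)] by (intro C1) (auto simp: L_v)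
      show "1 / c j * of_int (snd (v j)) \<le> \<sigma> N"
        using \<sigma>_strict_mono j(2) by (simp add: \<sigma>_def[symmetric] strict_mono_less_eq)
      show "0 \<le> 1 / c j * of_int (snd (v j))"
        using \<sigma>_nonneg[of j] by (simp add: \<sigma>_def)
    qed (use C in auto)
    have up: "G N \<le> 2 * P * l + 1 / b + P"
      unfolding l_def using inv by (intro G_upper N) auto
    have run: "real m \<le> P"
      if d: "det2 p u = 1" and h: "snd p \<ge> 0" "snd u \<ge> 1" and m: "m \<ge> 1"
        and Lp: "0 < L p" "0 < L p + real m * L u" "L p + real m * L u \<le> 1"
        and slope: "of_int (snd p) + real m * of_int (snd u) \<le> \<sigma> N * (L p + real m * L u)" for p u m
    proof -
      have hp: "real_of_int (snd p) \<ge> 0" "real_of_int (snd u) \<ge> 1" using h by auto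
      have mu: "real m * of_int (snd u) \<ge> 0" using hp by simp
      consider "L u > 0" | "L u < 0" using L_nonzero[of u] h by fastforce
      thus ?thesis
      proof cases
        case 1
        have "\<sigma> N * (L p + real m * L u) \<le> \<sigma> N * 1"
          using Lp \<sigma>1 by (intro mult_left_mono) auto
        hence "real m * of_int (snd u) \<le> \<sigma> N" using slope hp by linarith
        moreover have "real m \<le> C1 * (real m * of_int (snd u)) powr \<theta>"
          using 1 h m Lp by (intro C1) auto
        ultimately show ?thesis using C(2) mu by (intro toP)
      next
        case 2
        \<comment> \<open>The unit determinant of \<open>p\<close> and \<open>u\<close> bounds the
          starting value of a descending run by \<open>b / snd u\<close>. This limits its length,
          and also gains the second factor \<open>snd u\<close> in the slope estimate.\<close>
        have "L p * of_int (snd u) - of_int (snd p) * L u = b"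
          using det2_linear_form[of b a p u] d by simp
        moreover have "of_int (snd p) * L u \<le> 0" using hp 2 by (simp add: mult_nonneg_nonpos)
        ultimately have Lpu: "L p * of_int (snd u) \<le> 1" using ab by linarith
        have "real m * - L u * of_int (snd u) \<le> L p * of_int (snd u)"
          using Lp hp by (intro mult_right_mono) auto
        hence "real m * - L u * of_int (snd u) \<le> 1" using Lpu by linarith
        hence "real m \<le> C2 * (real m * (of_int (snd u))\<^sup>2) powr \<theta>"
          using 2 h m by (intro C2) auto
        moreover have "real m * (of_int (snd u))\<^sup>2 \<le> \<sigma> N"
        proof -
          have "real m * L u \<le> 0" using 2 by (simp add: mult_nonneg_nonpos)
          hence "\<sigma> N * (L p + real m * L u) \<le> \<sigma> N * L p"
            using \<sigma>1 by (intro mult_left_mono) auto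
          hence "real m * of_int (snd u) \<le> \<sigma> N * L p" using slope hp by linarith
          hence "real m * of_int (snd u) * of_int (snd u) \<le> \<sigma> N * L p * of_int (snd u)"
            using hp by (intro mult_right_mono) auto
          also have "\<dots> = \<sigma> N * (L p * of_int (snd u))" by simp
          also have "\<dots> \<le> \<sigma> N * 1"
            using Lpu \<sigma>1 by (intro mult_left_mono) auto
          finally show ?thesis by (simp add: power2_eq_square)
        qed
        ultimately show ?thesis using C(3) by (intro toP) auto
      qed
    qed
    have low: "G N \<ge> - (P + P * l) - 3"
      unfolding l_def by (rule G_lower[OF N]) (rule run)
    have S: "real_of_int (S n) = G N + 3 - c 1 / c 0 - c n / c N"
      by (simp add: S_eq G_def N_def)
    have "c 1 / c 0 \<le> 1 / b" using c_le_1[of 1] ab by (simp add: c_0 divide_right_mono)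
    moreover have "c n / c N \<le> P"
      using divide_right_mono[OF c_le_1[of n], of "c N"] c_pos[of N] inv[of N] N by simp
    moreover have "c 1 / c 0 \<ge> 0" "c n / c N \<ge> 0"
      using c_pos[of 0] c_pos[of 1] c_pos[of n] c_pos[of N] by auto
    moreover have "P * l \<ge> 0" using P l by simp
    moreover have "1 / b > 0" using ab by simp
    ultimately have "real_of_int (S n) \<le> 2 * P * l + 2 * P + (1 / b + 3)"
      "- real_of_int (S n) \<le> 2 * P * l + 2 * P + (1 / b + 3)"
      using S up low P by linarith+
    hence "\<bar>real_of_int (S n)\<bar> \<le> 2 * P * l + 2 * P + (1 / b + 3)" by simp
    also have "1 / b + 3 \<le> (1 / b + 3) * (\<sigma> N powr \<theta> * (1 + l))"
      using ab mult_mono[of 1 "\<sigma> N powr \<theta>" 1 "1 + l"] \<sigma>\<theta> l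
        mult_left_mono[of 1 "\<sigma> N powr \<theta> * (1 + l)" "1 / b + 3"] by simp
    also have
      "2 * P * l + 2 * P + (1 / b + 3) * (\<sigma> N powr \<theta> * (1 + l)) = (2 * C + 1 / b + 3) * \<sigma> N powr \<theta> * (1 + l)"
      by (simp add: P_def algebra_simps add_divide_distrib)
    finally show "\<bar>real_of_int (S n)\<bar> \<le> (2 * C + 1 / b + 3) * \<sigma> (Suc n) powr \<theta> * (1 + log 2 (\<sigma> (Suc n)))"
      by (simp add: l_def N_def)
  qed
qed

lemma S_bound:
  assumes gaps: "upper_gap \<theta>" "lower_gap \<theta>" and \<theta>: "0 < \<theta>" and \<eta>:
    "0 < \<eta>" "\<eta> < 1"
  obtains C where "C > 0"
    "\<And>n. \<bar>real_of_int (S n)\<bar> \<le> C * real (n + 2) powr ((\<theta> + \<eta>) / (1 - \<eta>))"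
proof -
  obtain C1 where C1: "C1 > 0"
    "\<And>n. \<bar>real_of_int (S n)\<bar> \<le> C1 * \<sigma> (Suc n) powr \<theta> * (1 + log 2 (\<sigma> (Suc n)))"
    using S_bound_\<sigma>[OF gaps \<theta>] by auto
  obtain C2 where C2: "C2 > 0"
    "\<And>n. n \<ge> 1 \<Longrightarrow> \<sigma> n \<le> C2 * real (Suc n) powr (1 / (1 - \<eta>))"
    using \<sigma>_growth[OF \<eta>] by auto
  define E where "E = 1 + 1 / (\<eta> * ln 2)"
  have E: "E > 0" using \<eta> by (simp add: E_def add_pos_pos)
  show thesis
  proof (rule that)
    show "C1 * E * C2 powr (\<theta> + \<eta>) > 0" using C1 E C2 by simp
    fix n
    define x where "x = \<sigma> (Suc n)"
    have x: "x \<ge> 1" by (simp add: x_def \<sigma>_ge_1)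
    have "\<bar>real_of_int (S n)\<bar> \<le> C1 * x powr \<theta> * (1 + log 2 x)" unfolding x_def
      by (rule C1)
    also have "\<dots> \<le> C1 * x powr \<theta> * (E * x powr \<eta>)"
      unfolding E_def using C1 x \<eta> by (intro mult_left_mono one_plus_log2_le_powr) auto
    also have "\<dots> = C1 * E * x powr (\<theta> + \<eta>)" by (simp add: powr_add)
    also have
      "\<dots> \<le> C1 * E * (C2 * real (n + 2) powr (1 / (1 - \<eta>))) powr (\<theta> + \<eta>)"
      using C2(2)[of "Suc n"] x C1 E \<theta> \<eta>
        by (intro mult_left_mono powr_mono2) (auto simp: x_def)
    also have
      "\<dots> = C1 * E * C2 powr (\<theta> + \<eta>) * real (n + 2) powr ((\<theta> + \<eta>) / (1 - \<eta>))"
      using C2 by (simp add: powr_mult powr_powr)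
    finally show "\<bar>real_of_int (S n)\<bar> \<le> C1 * E * C2 powr (\<theta> + \<eta>) * real (n + 2) powr ((\<theta> + \<eta>) / (1 - \<eta>))" .
  qed
qed

section \<open>The lower bound\<close>

text \<open>Large \<open>x\<close> force \<open>N\<close> to be large as well, since finitely many values \<open>S N\<close> are bounded.\<close>

lemma S_large_values:
  fixes C \<rho> y :: real
  assumes "C > 0" "y \<ge> 0" "y * \<rho> < 1"
    and ex: "\<And>M. \<exists>x N. M < x \<and> x \<le> 8 * \<bar>real_of_int (S N)\<bar> \<and> real N \<le> C * x powr \<rho>"
  shows "\<exists>N\<ge>N0. real N powr y < \<bar>real_of_int (S N)\<bar>"
proof -
  define B where "B = (\<Sum>N<N0. \<bar>real_of_int (S N)\<bar>)"
  \<comment> \<open>Beyond \<open>K\<close> one has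
    \<open>8 * C powr y * x powr (y * \<rho>) < x\<close>, while \<open>8 * B\<close> rules out all
    indices below \<open>N0\<close>.\<close>
  define K where "K = (8 * C powr y) powr (1 / (1 - y * \<rho>))"
  obtain x N where x: "max (max (8 * B) 1) K < x" "x \<le> 8 * \<bar>real_of_int (S N)\<bar>"
    "real N \<le> C * x powr \<rho>"
    using ex by blast
  have "N \<ge> N0"
  proof (rule ccontr)
    assume "\<not> N \<ge> N0"
    hence "\<bar>real_of_int (S N)\<bar> \<le> B" unfolding B_def by (intro member_le_sum) auto
    thus False using x by simp
  qed
  moreover have "real N powr y < \<bar>real_of_int (S N)\<bar>"
  proof -
    have "real N powr y \<le> (C * x powr \<rho>) powr y" using x assms by (intro powr_mono2) auto
    also have "\<dots> = C powr y * x powr (y * \<rho>)"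
      using assms x by (subst powr_mult) (simp_all add: powr_powr mult.commute)
    finally have 1: "real N powr y \<le> C powr y * x powr (y * \<rho>)" .
    have "K powr (1 - y * \<rho>) < x powr (1 - y * \<rho>)"
      using x assms by (intro powr_less_mono2) (auto simp: K_def)
    hence "8 * C powr y < x powr (1 - y * \<rho>)" using assms by (simp add: K_def powr_powr)
    hence "8 * C powr y * x powr (y * \<rho>) < x powr (1 - y * \<rho>) * x powr (y * \<rho>)"
      using x by (intro mult_strict_right_mono) auto
    also have "\<dots> = x" using x by (simp flip: powr_add)
    finally show ?thesis using 1 x by linarith
  qed
  ultimately show ?thesis by blast
qed

lemma index_le_\<sigma>: "real n \<le> \<sigma> n / b"
  using \<sigma>_ge[of n] ab by (simp add: field_simps)

text \<open>The point is to locate the large coefficient: its index satisfies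
  \<open>j <= \<sigma> j / b = q x / b\<close> with \<open>x = 1 / L u\<close>. Since
  \<open>q\<close> is at most of the order of the denominator \<open>P\<close>, and
  \<open>P <= x powr (1 / (e - 1))\<close>, the index is at most of order
  \<open>x powr (e / (e - 1))\<close>.\<close>

lemma S_large_even:
  assumes y: "0 \<le> y" "ereal y < exponent_ratio 1 (even_exponent s)"
  shows "\<exists>N\<ge>N0. real N powr y < \<bar>real_of_int (S N)\<bar>"
proof -
  have ge1: "even_exponent s \<ge> 1" unfolding even_exponent_eq
    by (intro side_exponent_ge_1 irrational) simp
  have "\<exists>e. y < (e - 1) / e \<and> 1 < e \<and> ereal e < even_exponent s"
  proof (cases "even_exponent s")
    case (real r)
    hence r: "r \<ge> 1" "y < (r - 1) / r"
      using y ge1 by (auto simp: exponent_ratio_def one_ereal_def)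
    moreover have "(r - 1) / r < 1" using r by simp
    ultimately have y1: "y < 1" by linarith
    hence "1 / (1 - y) < r" using r by (simp add: field_simps)
    then obtain e where e: "1 / (1 - y) < e" "e < r" using dense by blast
    moreover have "1 / (1 - y) \<ge> 1" using y y1 by simp
    ultimately have "e > 1" by linarith
    moreover have "y < (e - 1) / e" using e(1) y1 \<open>e > 1\<close> by (simp add: field_simps)
    ultimately show ?thesis using e real by auto
  next
    case PInf
    hence y1: "y < 1" using y by (simp add: exponent_ratio_def one_ereal_def)
    define e where "e = 1 / (1 - y) + 1"
    have "e > 1" using y1 by (simp add: e_def)
    moreover have "y < (e - 1) / e"
    proof -
      have "e * (1 - y) = 1 + (1 - y)" using y1 by (simp add: e_def distrib_right)
      hence "1 < e * (1 - y)" using y1 by simp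
      thus ?thesis using \<open>e > 1\<close> by (simp add: field_simps)
    qed
    ultimately show ?thesis using PInf by auto
  qed (use ge1 in auto)
  then obtain e where e: "y < (e - 1) / e" "1 < e" "ereal e < even_exponent s" by auto
  have inf: "infinite (approximants 1 s e)"
    using e(3) by (intro infinite_approximants) (simp add: even_exponent_eq)
  have s0: "s > 0" using ab by simp
  define C where "C = (s + 1) / b"
  show ?thesis
  proof (rule S_large_values)
    show "C > 0" using s0 ab by (simp add: C_def add_pos_pos)
    show "y * (e / (e - 1)) < 1" using e(1,2) by (simp add: field_simps)
    fix M :: real
    define M' where "M' = max M 3"
    have M': "M' \<ge> 3" "M' \<ge> M" by (auto simp: M'_def)
    obtain r where r: "r \<in> approximants 1 s e"
      "real_of_int (rat_denom r) > M' powr (1 / (e - 1))"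
      using approximants_large_denom[OF inf, of "M' powr (1 / (e - 1))"] e by auto
    obtain q p where qp: "quotient_of r = (q, p)" by (cases "quotient_of r")
    have p_eq: "rat_denom r = p" by (simp add: rat_denom_def qp)
    have p1: "p \<ge> 1" using rat_denom_pos[of r] by (simp add: p_eq)
    have r_eq: "of_rat r = of_int q / (of_int p :: real)"
      using quotient_of_div[OF qp] by (simp add: of_rat_divide)
    define P where "P = real_of_int p"
    have P1: "P \<ge> 1" using p1 by (simp add: P_def)
    define d where "d = of_int q / P - s"
    have d: "0 < d" "d < 1 / P powr e"
      using r(1) by (simp_all add: approximants_def p_eq r_eq d_def P_def)
    define u where "u = (- p, q)"
    define l where "l = L u"
    have l_eq: "l = a * P * d"
      using P1 ab by (simp add: l_def u_def linear_form_def d_def P_def field_simps)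
    have Pe: "P powr (e - 1) * P = P powr e" using P1 by (simp add: powr_diff)
    have l0: "l > 0" using l_eq d ab P1 by simp
    have "l \<le> 1 * P * d" unfolding l_eq using ab d P1 by (intro mult_right_mono) auto
    also have "\<dots> < P * (1 / P powr e)"
      using mult_strict_left_mono[OF d(2), of P] P1 by simp
    also have "\<dots> = 1 / P powr (e - 1)" using Pe P1 by (simp add: field_simps)
    finally have l_less: "l < 1 / P powr (e - 1)" .
    define x where "x = 1 / l"
    have x0: "x > 0" using l0 by (simp add: x_def)
    have Px: "P powr (e - 1) < x" using l_less l0 P1 by (simp add: x_def field_simps)
    have "(M' powr (1 / (e - 1))) powr (e - 1) < P powr (e - 1)"
      using r(2) e by (intro powr_less_mono2) (auto simp: p_eq P_def)
    hence xM: "M' < x" using Px e M' by (simp add: powr_powr)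
    have lx: "l = 1 / x" by (simp add: x_def)
    have "of_int q / P > 0" using d s0 by (simp add: d_def)
    hence q1: "q \<ge> 1" using P1 by (simp add: zero_less_divide_iff)
    have "0 < L u" "L u \<le> 1" "snd u \<ge> 0"
      using l0 xM M' q1 by (simp_all add: l_def[symmetric] lx) (simp add: u_def)
    then obtain j k where jk: "k \<ge> 1" "u = (k * fst (v j), k * snd (v j))"
      by (rule strip_vector_in_orbit)
    have lk: "l = of_int k * c j"
      unfolding l_def jk(2) L_v[symmetric] linear_form_def by (simp add: algebra_simps)
    have qk: "q = k * snd (v j)" using jk(2) by (simp add: u_def)
    have cl: "c j \<le> l"
      using mult_right_mono[of 1 "real_of_int k" "c j"] jk(1) c_pos[of j] by (simp add: lk)
    have "j \<noteq> 0" using qk q1 by (cases j) auto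
    then obtain i where i: "j = Suc i" by (cases j) auto
    have \<sigma>j: "\<sigma> j = of_int q / l"
      using jk(1) c_pos[of j] by (simp add: \<sigma>_def lk qk)
    \<comment> \<open>Both neighbours of \<open>c j\<close> exceed \<open>1 - c j\<close>.\<close>
    have "of_int (\<kappa> i) * c j > 2 - 2 * c j"
      using c_rec[of i] c_sum[of i] c_sum[of j] i by simp
    hence "of_int (\<kappa> i) > 2 / c j - 2" using c_pos[of j] by (simp add: field_simps)
    moreover have "2 / c j \<ge> 2 * x" using cl c_pos[of j] l0 by (simp add: x_def frac_le)
    ultimately have "of_int (\<kappa> i) - 3 > 2 * x - 5" by linarith
    moreover have "real_of_int (S j) = of_int (S i) + (of_int (\<kappa> i) - 3)"
      by (simp add: S_def i)
    \<comment> \<open>A jump above \<open>2 x - 5\<close> cannot happen between two sums that are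
      both small; \<open>x > 3\<close> makes one of them at least \<open>x / 8\<close> in
      modulus.\<close>
    ultimately have
      "x \<le> 8 * \<bar>real_of_int (S i)\<bar> \<or> x \<le> 8 * \<bar>real_of_int (S j)\<bar>"
      using xM M' by linarith
    then obtain N where N: "N \<le> j" "x \<le> 8 * \<bar>real_of_int (S N)\<bar>"
      using i by (meson le_SucI order_refl)
    have "real N \<le> real j" using N by simp
    also have "\<dots> \<le> \<sigma> j / b" by (rule index_le_\<sigma>)
    also have "\<dots> = of_int q * x / b" by (simp add: \<sigma>j lx)
    also have "of_int q \<le> P * (s + 1)"
    proof -
      have "1 / P powr e \<le> 1" using P1 e by (simp add: ge_one_powr_ge_zero)
      hence "of_int q / P \<le> s + 1" using d by (simp add: d_def)
      thus ?thesis using P1 by (simp add: field_simps)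
    qed
    also have "P \<le> x powr (1 / (e - 1))"
    proof -
      have "(P powr (e - 1)) powr (1 / (e - 1)) \<le> x powr (1 / (e - 1))"
        using Px e P1 by (intro powr_mono2) auto
      thus ?thesis using e P1 by (simp add: powr_powr)
    qed
    also have "x powr (1 / (e - 1)) * (s + 1) * x / b = C * x powr (1 / (e - 1) + 1)"
      using x0 by (simp add: powr_add C_def)
    also have "1 / (e - 1) + 1 = e / (e - 1)" using e by (simp add: field_simps)
    finally have "real N \<le> C * x powr (e / (e - 1))"
      using x0 s0 ab by (simp add: mult_right_mono divide_right_mono)
    thus "\<exists>x N. M < x \<and> x \<le> 8 * \<bar>real_of_int (S N)\<bar> \<and> real N \<le> C * x powr (e / (e - 1))"
      using N xM M' by (intro exI[of _ x] exI[of _ N]) auto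
  qed (use y in auto)
qed

text \<open>Whatever the orbit visits between the two vectors, reduction keeps the total weight, and
  the reduced chain between them is the progression with step \<open>u\<close>.\<close>

lemma orbit_segment_weight:
  assumes "i < i'" "det2 (v i) u = 1" "det2 (v i') u = 1" "det2 (v i) (v i') = int m" "m \<ge> 1"
  shows "G i' - G i = (\<Sum>k<m. edge_weight (c i + real k * L u) (c i + real (Suc k) * L u))"
proof -
  define z where "z = (\<lambda>n. v (i + n))"
  define n where "n = i' - i"
  have z: "chain z n" "n \<ge> 1" "L (z k) > 0" for k
    using assms(1) det2_v by (simp_all add: chain_def z_def n_def L_v c_pos)
  obtain w r where w: "reduced w r" "r \<ge> 1" "w 0 = z 0" "w r = z n"
    "w ` {..r} \<subseteq> z ` {..n}"
    "chain_weight L w r = chain_weight L z n"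
    using reduced_subchain[OF z] .
  have zn: "z 0 = v i" "z n = v i'" using assms(1) by (simp_all add: z_def n_def)
  have "chain_weight L w r = (\<Sum>k<m. edge_weight (L (w 0) + real k * L u) (L (w 0) + real (Suc k) * L u))"
    using assms w zn by (intro reduced_segment_weight) auto
  moreover have "chain_weight L z n = G i' - G i"
  proof -
    have "chain_weight L z n = (\<Sum>j<n. edge_weight (c (i + j)) (c (Suc (i + j))))"
      by (simp add: chain_weight_def z_def L_v)
    moreover have "G (i + n) = G i + (\<Sum>j<n. edge_weight (c (i + j)) (c (Suc (i + j))))" for n
      by (induction n) (simp_all add: G_def)
    moreover have "i + n = i'" using assms(1) by (simp add: n_def)
    ultimately show ?thesis by (metis add_diff_cancel_left')
  qed
  ultimately show ?thesis using w zn by (simp add: L_v)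
qed

text \<open>The run starts at a vector \<open>w\<close> of value about \<open>b / H\<close>, where
  \<open>H\<close> is the height of \<open>u\<close>, and each step lowers the value by \<epsilon>.
  Its final slope is at most of order \<open>x H^2\<close>, and \<open>H^2\<close> is at most of
  order \<open>x powr (2 / (e - 2))\<close>; this yields the power
  \<open>e / (e - 2)\<close>.\<close>

lemma S_large_odd:
  assumes y: "0 \<le> y" "ereal y < exponent_ratio 2 (odd_exponent s)"
  shows "\<exists>N\<ge>N0. real N powr y < \<bar>real_of_int (S N)\<bar>"
proof -
  have ge1: "odd_exponent s \<ge> 1" unfolding odd_exponent_eq
    by (intro side_exponent_ge_1 irrational) simp
  have "\<exists>e. y < (e - 2) / e \<and> 2 < e \<and> ereal e < odd_exponent s"
  proof (cases "odd_exponent s")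
    case (real r)
    hence r: "r \<ge> 1" "y < (r - 2) / r"
      using y ge1 by (auto simp: exponent_ratio_def one_ereal_def)
    moreover have "(r - 2) / r < 1" using r by simp
    ultimately have y1: "y < 1" by linarith
    hence "2 / (1 - y) < r" using r by (simp add: field_simps)
    then obtain e where e: "2 / (1 - y) < e" "e < r" using dense by blast
    moreover have "2 / (1 - y) \<ge> 2" using y y1 by (simp add: field_simps)
    ultimately have "e > 2" by linarith
    moreover have "y < (e - 2) / e" using e(1) y1 \<open>e > 2\<close> by (simp add: field_simps)
    ultimately show ?thesis using e real by auto
  next
    case PInf
    hence y1: "y < 1" using y by (simp add: exponent_ratio_def one_ereal_def)
    define e where "e = 2 / (1 - y) + 1"
    have "2 / (1 - y) \<ge> 2" using y y1 by (simp add: field_simps)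
    hence "e > 2" by (simp add: e_def)
    moreover have "y < (e - 2) / e"
    proof -
      have "2 / (1 - y) * (1 - y) = 2"
        by (subst times_divide_eq_left, subst nonzero_mult_div_cancel_right) (use y1 in auto)
      hence "e * (1 - y) = 2 + (1 - y)" unfolding e_def distrib_right by simp
      hence "2 < e * (1 - y)" using y1 by simp
      thus ?thesis using \<open>e > 2\<close> by (simp add: field_simps)
    qed
    ultimately show ?thesis using PInf by auto
  qed (use ge1 in auto)
  then obtain e where e: "y < (e - 2) / e" "2 < e" "ereal e < odd_exponent s" by auto
  have inf: "infinite (approximants (- 1) s e)"
    using e(3) by (intro infinite_approximants) (simp add: odd_exponent_eq)
  have s0: "s > 0" using ab by simp
  define D where "D = s\<^sup>2 * (4 * s / b) powr (2 / (e - 2))"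
  define C where "C = 8 / b\<^sup>2 * D"
  show ?thesis
  proof (rule S_large_values)
    show "C > 0" using ab by (simp add: C_def D_def)
    show "y * (e / (e - 2)) < 1" using e(1,2) by (simp add: field_simps)
    fix M :: real
    \<comment> \<open>The sums will differ by more than \<open>x - 5\<close>, so one has modulus
      above \<open>(x - 5) / 2\<close>; this is at least \<open>x / 8\<close> once
      \<open>x >= 7\<close>.\<close>
    define M' where "M' = max (M + 1) 7"
    have M': "M' \<ge> 7" "M' > M" by (auto simp: M'_def)
    \<comment> \<open>The first entry makes the run long (\<open>x >= M'\<close>), the second makes
      the numerator \<open>q\<close> positive.\<close>
    define B where "B = max ((4 * s / b * M') powr (1 / (e - 2))) (1 / s)"
    obtain r where r: "r \<in> approximants (- 1) s e" "real_of_int (rat_denom r) > B"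
      using approximants_large_denom[OF inf, of B] e by auto
    obtain q p where qp: "quotient_of r = (q, p)" by (cases "quotient_of r")
    have p_eq: "rat_denom r = p" by (simp add: rat_denom_def qp)
    have p1: "p \<ge> 1" using rat_denom_pos[of r] by (simp add: p_eq)
    have r_eq: "of_rat r = of_int q / (of_int p :: real)"
      using quotient_of_div[OF qp] by (simp add: of_rat_divide)
    define P where "P = real_of_int p"
    have P1: "P \<ge> 1" using p1 by (simp add: P_def)
    have PB: "P > 1 / s" "P > (4 * s / b * M') powr (1 / (e - 2))"
      using r(2) by (simp_all add: P_def p_eq B_def)
    define d where "d = s - of_int q / P"
    have d: "0 < d" "d < 1 / P powr e"
      using r(1) by (simp_all add: approximants_def p_eq r_eq d_def P_def)
    define u where "u = (- p, q)"
    define \<epsilon> where "\<epsilon> = - L u"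
    have \<epsilon>_eq: "\<epsilon> = a * P * d"
      using P1 ab by (simp add: \<epsilon>_def u_def linear_form_def d_def P_def field_simps)
    have \<epsilon>0: "\<epsilon> > 0" using \<epsilon>_eq d ab P1 by simp
    have Pe: "P powr (e - 2) * P * P = P powr e" using P1 by (simp add: powr_diff power2_eq_square)
    have q1: "q \<ge> 1"
    proof -
      have "P powr 1 \<le> P powr e" using P1 e by (intro powr_mono) auto
      hence "1 / P powr e \<le> 1 / P" using P1 by (simp add: frac_le)
      also have "1 / P < 1 / (1 / s)"
        using PB(1) ab P1 by (intro divide_strict_left_mono mult_pos_pos) auto
      also have "1 / (1 / s) = s" by simp
      finally have "of_int q / P > 0" using d by (simp add: d_def)
      thus ?thesis using P1 by (simp add: zero_less_divide_iff)
    qed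
    define H where "H = real_of_int q"
    have H1: "H \<ge> 1" using q1 by (simp add: H_def)
    have HP: "H < P * s" using d P1 by (simp add: d_def H_def field_simps)
    have \<epsilon>H: "\<epsilon> * H * P powr (e - 2) \<le> s"
    proof -
      have "\<epsilon> \<le> 1 * P * d" unfolding \<epsilon>_eq
        using ab d P1 by (intro mult_right_mono) auto
      also have "\<dots> \<le> P * (1 / P powr e)"
        using mult_left_mono[OF less_imp_le[OF d(2)], of P] P1 by simp
      finally have "\<epsilon> * H \<le> (P * (1 / P powr e)) * (P * s)"
        using HP H1 P1 by (intro mult_mono) auto
      hence "\<epsilon> * H * P powr (e - 2) \<le> (P * (1 / P powr e)) * (P * s) * P powr (e - 2)"
        by (intro mult_right_mono) auto
      also have "\<dots> = s * (P powr (e - 2) * P * P) / P powr e" by (simp add: mult_ac)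
      also have "\<dots> = s" unfolding Pe using P1 by simp
      finally show ?thesis .
    qed
    have PeM: "4 * s / b * M' < P powr (e - 2)"
    proof -
      have "((4 * s / b * M') powr (1 / (e - 2))) powr (e - 2) < P powr (e - 2)"
        using PB(2) e by (intro powr_less_mono2) auto
      thus ?thesis using e s0 ab M' by (simp add: powr_powr)
    qed
    \<comment> \<open>The height bound \<open>y0 < q\<close> keeps
      \<open>L w * H = b - y0 \<epsilon>\<close> between \<open>b / 2\<close> and
      \<open>b\<close>.\<close>
    obtain x0 y0 where xy: "x0 * q + y0 * p = 1" "0 \<le> y0" "y0 < q"
      using bezout_reduced[of p q] quotient_of_coprime[OF qp] q1 by (auto simp: coprime_commute)
    define w where "w = (x0, y0)"
    have wu: "det2 w u = 1" using xy by (simp add: w_def u_def det2_def algebra_simps)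
    have Lw: "L w * H + of_int y0 * \<epsilon> = b"
      using det2_linear_form[of b a w u] wu by (simp add: w_def u_def \<epsilon>_def H_def)
    have y0: "0 \<le> of_int y0 * \<epsilon>" "of_int y0 * \<epsilon> \<le> \<epsilon> * H"
      using xy \<epsilon>0 by (simp_all add: H_def mult.commute)
    have LwH: "L w * H \<le> b" using Lw y0 by simp
    have \<epsilon>HM: "\<epsilon> * H * (4 * M') \<le> b"
    proof -
      have "\<epsilon> * H * (4 * s / b * M') \<le> \<epsilon> * H * P powr (e - 2)"
        using PeM \<epsilon>0 H1 by (intro mult_left_mono) auto
      hence "\<epsilon> * H * (4 * s / b * M') \<le> s" using \<epsilon>H by linarith
      hence "(\<epsilon> * H * (4 * M')) * (s / b) \<le> b * (s / b)"
        using ab by (simp add: mult_ac)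
      thus ?thesis using s0 ab by (subst (asm) mult_le_cancel_right) auto
    qed
    have "\<epsilon> * H * 28 \<le> \<epsilon> * H * (4 * M')"
      using M' \<epsilon>0 H1 by (intro mult_left_mono) auto
    moreover have "\<epsilon> * H > 0" using \<epsilon>0 H1 by simp
    ultimately have "\<epsilon> * H \<le> b / 2" using \<epsilon>HM by linarith
    hence LwH2: "b / 2 \<le> L w * H" using Lw y0 by linarith
    have Lw0: "L w > 0"
    proof -
      have "0 < L w * H" using LwH2 ab by simp
      thus ?thesis using H1 by (simp add: zero_less_mult_iff)
    qed
    have Lw1: "L w \<le> 1"
    proof -
      have "L w * 1 \<le> L w * H" using Lw0 H1 by (intro mult_left_mono) auto
      thus ?thesis using LwH ab by simp
    qed
    \<comment> \<open>Within \<open>x\<close> steps the values stay above half of the starting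
      value, so the run remains in the strip and its edges weigh almost -1.\<close>
    define x where "x = L w / (2 * \<epsilon>)"
    have x\<epsilon>: "x * (2 * \<epsilon>) = L w" using \<epsilon>0 by (simp add: x_def)
    have x_ge: "b / (4 * (\<epsilon> * H)) \<le> x"
      using LwH2 \<epsilon>0 H1 by (simp add: x_def field_simps)
    have xM: "M' \<le> x"
    proof -
      have "M' \<le> b / (4 * (\<epsilon> * H))"
        using \<epsilon>HM \<epsilon>0 H1 by (simp add: field_simps)
      thus ?thesis using x_ge by linarith
    qed
    have xP: "P powr (e - 2) \<le> 4 * s / b * x"
    proof -
      have "P powr (e - 2) \<le> s / (\<epsilon> * H)"
        using \<epsilon>H \<epsilon>0 H1 by (subst pos_le_divide_eq) (simp_all add: mult_ac)
      also have "\<dots> = 4 * s / b * (b / (4 * (\<epsilon> * H)))" using ab by simp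
      also have "\<dots> \<le> 4 * s / b * x" using x_ge s0 ab by (intro mult_left_mono) auto
      finally show ?thesis .
    qed
    define m where "m = nat \<lfloor>x\<rfloor>"
    have m: "real m \<le> x" "x < real m + 1" "m \<ge> 1"
      using xM M' by (auto simp: m_def le_nat_floor)
    have m\<epsilon>: "real k * \<epsilon> \<le> L w / 2" if "k \<le> m" for k
    proof -
      have "real k * \<epsilon> \<le> x * \<epsilon>"
        using that m \<epsilon>0 by (intro mult_right_mono) auto
      thus ?thesis using x\<epsilon> by simp
    qed
    define w' where "w' = (x0 - int m * p, y0 + int m * q)"
    have Lw': "L w' = L w - real m * \<epsilon>"
      by (simp add: w'_def w_def \<epsilon>_def u_def linear_form_def algebra_simps)
    have w'u: "det2 w' u = 1" using xy by (simp add: w'_def u_def det2_def algebra_simps)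
    have ww': "det2 w w' = int m"
    proof -
      have "det2 w w' = int m * (x0 * q + y0 * p)"
        by (simp add: w_def w'_def det2_def algebra_simps)
      thus ?thesis using xy by simp
    qed
    have Lw'_bounds: "L w / 2 \<le> L w'" "L w' \<le> L w"
      using m\<epsilon>[of m] Lw' \<epsilon>0 by auto
    have "snd w \<ge> 0" "snd w' \<ge> 0" using xy q1 by (simp_all add: w_def w'_def)
    obtain i where i: "w = v i"
      using primitive_strip_vector_in_orbit[OF Lw0 Lw1 \<open>snd w \<ge> 0\<close> wu] .
    have "0 < L w'" "L w' \<le> 1" using Lw0 Lw1 Lw'_bounds by simp_all
    then obtain i' where i': "w' = v i'"
      using primitive_strip_vector_in_orbit[OF _ _ \<open>snd w' \<ge> 0\<close> w'u] by auto
    have ci: "c i = L w" "c i' = L w'" by (simp_all add: i i' L_v)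
    have "\<sigma> i < \<sigma> i'"
    proof -
      have "real_of_int y0 < of_int y0 + real m * H" using m H1 by simp
      moreover have "real_of_int y0 \<ge> 0" using xy by simp
      ultimately have "of_int y0 / L w < (of_int y0 + real m * H) / L w'"
        using Lw0 Lw'_bounds by (intro frac_less) auto
      thus ?thesis by (simp add: \<sigma>_def i[symmetric] i'[symmetric] ci w_def w'_def H_def)
    qed
    hence ii': "i < i'" using \<sigma>_strict_mono by (simp add: strict_mono_less)
    have "G i' - G i = (\<Sum>k<m. edge_weight (c i + real k * L u) (c i + real (Suc k) * L u))"
      using wu w'u ww' m ii' by (intro orbit_segment_weight) (auto simp: i[symmetric] i'[symmetric])
    \<comment> \<open>Each weight is at most \<open>1 / x^2 - 1\<close>; since
      \<open>m <= x^2\<close>, the excess over -1 adds up to at most 1.\<close>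
    also have "\<dots> \<le> (\<Sum>k<m. 1 / real m - 1)"
    proof (rule sum_mono)
      fix k assume k: "k \<in> {..<m}"
      have "edge_weight (c i + real k * L u) (c i + real (Suc k) * L u) \<le> (\<epsilon> / (L w / 2))\<^sup>2 - 1"
        using m\<epsilon>[of k] m\<epsilon>[of "Suc k"] k Lw0 \<epsilon>0
        by (intro edge_weight_le) (auto simp: ci \<epsilon>_def algebra_simps)
      also have "\<epsilon> / (L w / 2) = 1 / x" using \<epsilon>0 by (simp add: x_def)
      also have "(1 / x)\<^sup>2 \<le> 1 / real m"
      proof -
        have "real m * 1 \<le> x * x" using m xM M' by (intro mult_mono) auto
        hence "1 / (x * x) \<le> 1 / real m" using m by (intro frac_le) auto
        thus ?thesis by (simp add: power_divide power2_eq_square)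
      qed
      finally show "edge_weight (c i + real k * L u) (c i + real (Suc k) * L u) \<le> 1 / real m - 1" by simp
    qed
    also have "\<dots> = 1 - real m" using m by (simp add: algebra_simps)
    finally have Gdiff: "G i' - G i \<le> 1 - real m" .
    obtain j where j: "i' = Suc j" using ii' by (cases i') auto
    \<comment> \<open>\<open>S i\<close> belongs to \<open>G (Suc i)\<close>, one edge beyond the
      start of the run. In that edge \<open>c i / c (Suc i)\<close> cancels, so the shift costs at
      most 3.\<close>
    have "real_of_int (S j) - of_int (S i) = (G i' - G (Suc i)) - c j / c i' + c i / c (Suc i)"
      by (simp add: S_eq[of j] S_eq[of i] G_def j)
    also have "\<dots> = (G i' - G i) - c j / c i' + 3 - c (Suc i) / c i"
      by (simp add: G_def edge_weight_def)
    also have "\<dots> \<le> 4 - real m"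
    proof -
      have "c j / c i' \<ge> 0" "c (Suc i) / c i \<ge> 0" using c_pos by (simp_all add: less_imp_le)
      thus ?thesis using Gdiff by linarith
    qed
    finally have
      "x \<le> 8 * \<bar>real_of_int (S i)\<bar> \<or> x \<le> 8 * \<bar>real_of_int (S j)\<bar>"
      using m xM M' by linarith
    then obtain N where N: "N \<le> i'" "x \<le> 8 * \<bar>real_of_int (S N)\<bar>"
      using ii' j by (meson le_SucI less_imp_le order_refl)
    have "real N \<le> real i'" using N by simp
    also have "\<dots> \<le> \<sigma> i' / b" by (rule index_le_\<sigma>)
    also have "\<sigma> i' \<le> (2 * x * H) / (b / (4 * H))"
    proof -
      have "\<sigma> i' = (of_int y0 + real m * H) / L w'"
        by (simp add: \<sigma>_def i'[symmetric] ci w'_def H_def)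
      also have "\<dots> \<le> (2 * x * H) / (b / (4 * H))"
      proof (rule frac_le)
        have "of_int y0 \<le> 1 * H" using xy by (simp add: H_def)
        also have "\<dots> \<le> x * H" using xM M' H1 by (intro mult_right_mono) auto
        finally have "of_int y0 \<le> x * H" .
        moreover have "real m * H \<le> x * H" using m H1 by (intro mult_right_mono) auto
        ultimately show "of_int y0 + real m * H \<le> 2 * x * H" by simp
        have "b / (4 * H) \<le> L w / 2" using LwH2 H1 by (simp add: field_simps)
        thus "b / (4 * H) \<le> L w'" using Lw'_bounds by simp
      qed (use xM M' H1 ab in auto)
      finally show ?thesis .
    qed
    also have "(2 * x * H) / (b / (4 * H)) / b = 8 / b\<^sup>2 * x * H\<^sup>2"
      using ab H1 by (simp add: field_simps power2_eq_square)
    also have "H\<^sup>2 \<le> D * x powr (2 / (e - 2))"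
    proof -
      have "H\<^sup>2 \<le> (P * s)\<^sup>2" using HP H1 by (intro power_mono) auto
      also have "\<dots> = s\<^sup>2 * P powr 2"
        using P1 by (simp add: power_mult_distrib power_divide mult.commute)
      also have "P powr 2 = (P powr (e - 2)) powr (2 / (e - 2))"
        unfolding powr_powr using e nonzero_mult_div_cancel_left[of "e - 2" 2] by simp
      also have "\<dots> \<le> (4 * s / b * x) powr (2 / (e - 2))"
        using xP e by (intro powr_mono2) auto
      also have "\<dots> = (4 * s / b) powr (2 / (e - 2)) * x powr (2 / (e - 2))"
        using s0 ab xM M' by (subst powr_mult) auto
      finally show ?thesis using ab by (simp add: D_def mult_ac)
    qed
    also have "8 / b\<^sup>2 * x * (D * x powr (2 / (e - 2))) = C * x powr (2 / (e - 2) + 1)"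
      using xM M' by (simp add: powr_add C_def)
    also have "2 / (e - 2) + 1 = e / (e - 2)" using e by (simp add: field_simps)
    finally have "real N \<le> C * x powr (e / (e - 2))"
      using ab xM M' by (simp add: mult_left_mono divide_right_mono)
    thus "\<exists>x N. M < x \<and> x \<le> 8 * \<bar>real_of_int (S N)\<bar> \<and> real N \<le> C * x powr (e / (e - 2))"
      using N xM M' by (intro exI[of _ x] exI[of _ N]) auto
  qed (use y in auto)
qed

section \<open>The limit superior\<close>

definition growth_ratio :: "nat \<Rightarrow> ereal" where
  "growth_ratio n = elog \<bar>real_of_int (f_neg (a, b) n)\<bar> / ereal (ln (real n))"

definition growth_exponent :: ereal where
  "growth_exponent = max (exponent_ratio 1 (even_exponent s)) (exponent_ratio 2 (odd_exponent s))"

lemma growth_exponent_nonneg: "growth_exponent \<ge> 0"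
proof -
  have "even_exponent s \<ge> 1" unfolding even_exponent_eq
    by (intro side_exponent_ge_1 irrational) simp
  hence "exponent_ratio 1 (even_exponent s) \<ge> 0"
    by (cases "even_exponent s") (auto simp: exponent_ratio_def one_ereal_def)
  thus ?thesis by (simp add: growth_exponent_def max.coboundedI1)
qed

lemma eventually_growth_ratio_less:
  assumes "growth_exponent < ereal y"
  shows "\<forall>\<^sub>F n in sequentially. growth_ratio n < ereal y"
proof -
  obtain t where t: "growth_exponent < ereal t" "t < y"
    using ereal_dense2[OF assms] by (auto simp: less_ereal.simps)
  have "0 < ereal t" using growth_exponent_nonneg t(1) by (rule le_less_trans)
  hence t0: "t > 0" by simp
  \<comment> \<open>Capped at 1, where the gap conditions hold regardless of the exponents.\<close>
  define \<theta> where "\<theta> = min t 1"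
  have \<theta>: "0 < \<theta>" "\<theta> \<le> 1" "\<theta> < y"
    using t0 t by (auto simp: \<theta>_def)
  have \<theta>': "\<theta> = 1 \<or> growth_exponent < ereal \<theta>"
    using t by (auto simp: \<theta>_def min_def)
  have gaps: "upper_gap \<theta>" "lower_gap \<theta>"
    using \<theta> \<theta>'
      by (auto intro!: upper_gap_of_exponent lower_gap_of_exponent simp: growth_exponent_def)
  \<comment> \<open>The requirement \<open>(\<theta> + \<eta>) / (1 - \<eta>) < y\<close> amounts to
    \<open>\<eta> (1 + y) < y - \<theta>\<close>; half of the admissible value is taken.\<close>
  define \<eta> where "\<eta> = (y - \<theta>) / (2 * (1 + y))"
  have "\<eta> * (1 + y) = (y - \<theta>) / (2 * (1 + y)) * (1 + y)" by (simp add: \<eta>_def)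
  also have "\<dots> = (y - \<theta>) / 2" using \<theta> by (auto simp: divide_simps)
  finally have "\<eta> * (1 + y) = (y - \<theta>) / 2" .
  hence "\<eta> * (1 + y) < y - \<theta>" using \<theta> by simp
  moreover have "0 < \<eta>" "\<eta> < 1" using \<theta> by (simp_all add: \<eta>_def field_simps)
  ultimately have \<eta>: "0 < \<eta>" "\<eta> < 1" "\<eta> * (1 + y) < y - \<theta>" by simp_all
  define \<rho> where "\<rho> = (\<theta> + \<eta>) / (1 - \<eta>)"
  have \<rho>: "\<rho> > 0" "\<rho> < y"
    using \<eta> \<theta> by (simp_all add: \<rho>_def field_simps)
  obtain C where C: "C > 0"
    "\<And>n. \<bar>real_of_int (S n)\<bar> \<le> C * real (n + 2) powr \<rho>"
    using S_bound[OF gaps \<theta>(1) \<eta>(1,2)] unfolding \<rho>_def by auto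
  define K where "K = (C * 4 powr \<rho>) powr (1 / (y - \<rho>))"
  obtain n0 :: nat where n0: "K < real n0" using reals_Archimedean2 by blast
  have "growth_ratio n < ereal y" if n: "n \<ge> max n0 2" for n
  proof -
    have "\<bar>real_of_int (f_neg (a, b) n)\<bar> \<le> C * real (Suc n + 2) powr \<rho>"
      unfolding f_neg_eq by (rule C)
    also have "\<dots> \<le> C * (4 * real n) powr \<rho>"
      using n C \<rho> by (intro mult_left_mono powr_mono2) auto
    also have "\<dots> = C * 4 powr \<rho> * real n powr \<rho>" by (simp add: powr_mult)
    also have "\<dots> < real n powr (y - \<rho>) * real n powr \<rho>"
    proof (rule mult_strict_right_mono)
      have "K powr (y - \<rho>) < real n powr (y - \<rho>)"
        using n0 n \<rho> by (intro powr_less_mono2) (auto simp: K_def)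
      thus "C * 4 powr \<rho> < real n powr (y - \<rho>)"
        using C \<rho> by (simp add: K_def powr_powr)
    qed (use n in auto)
    also have "\<dots> = real n powr y" by (simp flip: powr_add)
    finally show ?thesis using n by (simp add: growth_ratio_def elog_ratio_less_iff)
  qed
  thus ?thesis unfolding eventually_sequentially by blast
qed

lemma frequently_less_growth_ratio:
  assumes "ereal y < growth_exponent"
  shows "\<exists>\<^sub>F n in sequentially. ereal y < growth_ratio n"
  unfolding frequently_sequentially
proof
  fix n0
  \<comment> \<open>\<open>S N\<close> is \<open>f_neg\<close> at \<open>N - 1\<close>, and
    \<open>N >= 3\<close> makes the logarithm of \<open>N - 1\<close> positive.\<close>
  have "\<exists>N\<ge>n0 + 3. real (N - 1) powr y < \<bar>real_of_int (S N)\<bar>"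
  proof (cases "y < 0")
    \<comment> \<open>For negative \<open>y\<close> a nonzero integer suffices; infinitely many of
      these keep the limit superior from being negative when the growth exponent is 0.\<close>
    case True
    obtain N where N: "N \<ge> n0 + 3" "S N \<noteq> 0" using S_frequently_nonzero by blast
    have "real (N - 1) powr y < real (N - 1) powr 0" using N True by (intro powr_less_mono) auto
    hence "real (N - 1) powr y < 1" using N by simp
    thus ?thesis using N by (intro exI[of _ N]) auto
  next
    case False
    then obtain N where N: "N \<ge> n0 + 3" "real N powr y < \<bar>real_of_int (S N)\<bar>"
      using S_large_even[of y "n0 + 3"] S_large_odd[of y "n0 + 3"] assms
      by (auto simp: growth_exponent_def less_max_iff_disj)
    moreover have "real (N - 1) powr y \<le> real N powr y" using False by (intro powr_mono2) auto
    ultimately show ?thesis by (intro exI[of _ N]) auto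
  qed
  then obtain N where N: "N \<ge> n0 + 3" "real (N - 1) powr y < \<bar>real_of_int (S N)\<bar>"
    by blast
  have "f_neg (a, b) (N - 1) = S N" using N by (simp add: f_neg_eq)
  hence "ereal y < growth_ratio (N - 1)"
    unfolding growth_ratio_def using N by (subst less_elog_ratio_iff) auto
  thus "\<exists>n\<ge>n0. ereal y < growth_ratio n" using N by (intro exI[of _ "N - 1"]) auto
qed

lemma limsup_growth_ratio: "limsup growth_ratio = growth_exponent"
proof (rule antisym)
  show "limsup growth_ratio \<le> growth_exponent"
    unfolding Limsup_le_iff
  proof (intro allI impI)
    fix y assume y: "y > growth_exponent"
    obtain t where "growth_exponent < ereal t" "ereal t < y" using ereal_dense2[OF y] by auto
    with eventually_growth_ratio_less[of t] show "\<forall>\<^sub>F n in sequentially. growth_ratio n < y"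
      by (auto elim!: eventually_mono intro: less_trans)
  qed
  show "growth_exponent \<le> limsup growth_ratio"
  proof (rule ccontr)
    assume "\<not> growth_exponent \<le> limsup growth_ratio"
    then obtain t where t: "limsup growth_ratio < ereal t" "ereal t < growth_exponent"
      using ereal_dense2[of "limsup growth_ratio" growth_exponent] by (auto simp: not_le)
    have "\<forall>\<^sub>F n in sequentially. growth_ratio n < ereal t"
      using t(1) Limsup_le_iff[of sequentially growth_ratio "limsup growth_ratio"] by auto
    hence "\<forall>\<^sub>F n in sequentially. \<not> ereal t < growth_ratio n"
      by eventually_elim auto
    thus False using frequently_less_growth_ratio[OF t(2)] by (simp add: frequently_def)
  qed
qed

end

theorem theorem1p3:
  fixes a b :: real
  assumes "(a, b) \<in> BCZ_triangle"
    and "b / a \<notin> \<rat>"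
  shows "limsup (\<lambda>n. elog \<bar>real_of_int (f_neg (a, b) n)\<bar> / ereal (ln (real n))) =
    max (exponent_ratio 1 (even_exponent (b / a))) (exponent_ratio 2 (odd_exponent (b / a)))"
proof -
  interpret bcz_orbit a b using assms by unfold_locales
  show ?thesis
    using limsup_growth_ratio by (simp add: growth_ratio_def[abs_def] growth_exponent_def)
qed

end
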